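(* Let $(x_1,x_2,x_3,x_4)$ be the usual coordinates on $\mathbb{R}^4$, let $\partial_i=\partial_{x_i}$, and let $\mathcal{O}=\{(x_1,x_2,x_3,x_4)\in\mathbb{R}^4: x_3>0,\ x_4>0\}$. For $\beta>0$ let $\mathcal{M}_\beta=(\mathcal{O},g_\beta)$ be the Riemannian manifold whose metric has the non-zero components $$g_\beta(\partial_1,\partial_1)=x_3^2,\quad g_\beta(\partial_2,\partial_2)=(x_3+\beta x_4)^2,\quad g_\beta(\partial_3,\partial_3)=1,\quad g_\beta(\partial_4,\partial_4)=1$$ (all components $g_\beta(\partial_i,\partial_j)$ with $i\neq j$ vanish). Then: (1) $\mathcal{M}_\beta$ is an irreducible skew Tsankov manifold. (2) The scalar curvature of $\mathcal{M}_\beta$ is $\tau_{\mathcal{M}_\beta}=-2x_3^{-1}(x_3+\beta x_4)^{-1}$. (3) If $\beta_1,\beta_2>0$ and $\beta_1\ne\beta_2$, then $\mathcal{M}_{\beta_1}$ is not isometric to $\mathcal{M}_{\beta_2}$.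
   Context: For a pseudo-Riemannian manifold $\mathcal{M}=(M,g)$, let $R$ be the curvature tensor of the Levi-Civita connection and let $\mathcal{R}(x,y)$ be the skew-symmetric curvature operator, $g(\mathcal{R}(x,y)z,w)=R(x,y,z,w)$. $\mathcal{M}$ is skew Tsankov if for every $P\in M$, $\mathcal{R}(x_1,x_2)\mathcal{R}(x_3,x_4)=\mathcal{R}(x_3,x_4)\mathcal{R}(x_1,x_2)$ for all $x_1,x_2,x_3,x_4\in T_PM$. The scalar curvature $\tau$ is normalized so that the unit round $2$-sphere has $\tau=+2$. $\mathcal{M}$ is reducible at a point $P\in M$ if there is a neighborhood $\mathcal{U}$ of $P$ in $M$ and a Cartesian product decomposition $\mathcal{U}=\mathcal{U}_1\times\mathcal{U}_2$ into manifolds of positive dimension which induces an orthogonal decomposition of the metric $g_{\mathcal{U}}=g_{\mathcal{U}_1}\oplus g_{\mathcal{U}_2}$. Irreducible here means that $\mathcal{M}$ is not reducible at any point of $M$. *)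

theory Defs
  imports "HOL-Analysis.Analysis"
begin

section \<open>Smooth maps on open sets\<close>

text \<open>
  For an open set \<open>S\<close>, \<open>Ck_on k f S\<close> says that \<open>f\<close> is of class \<open>C\<^sup>k\<close> on \<open>S\<close>, through iterated
  partial derivatives.
\<close>

primrec Ck_on :: "nat \<Rightarrow> ('a::euclidean_space \<Rightarrow> 'b::real_normed_vector) \<Rightarrow> 'a set \<Rightarrow> bool" where
  "Ck_on 0 f S \<longleftrightarrow> continuous_on S f"
| "Ck_on (Suc k) f S \<longleftrightarrow>
     f differentiable_on S \<and> (\<forall>b\<in>Basis. Ck_on k (\<lambda>x. frechet_derivative f (at x) b) S)"

definition smooth_on :: "('a::euclidean_space \<Rightarrow> 'b::real_normed_vector) \<Rightarrow> 'a set \<Rightarrow> bool" where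
  "smooth_on f S \<longleftrightarrow> (\<forall>k. Ck_on k f S)"

definition diffeomorphism ::
  "('a::euclidean_space) set \<Rightarrow> ('b::euclidean_space) set \<Rightarrow> ('a \<Rightarrow> 'b) \<Rightarrow> bool" where
  "diffeomorphism M N \<phi> \<longleftrightarrow>
     smooth_on \<phi> M \<and> bij_betw \<phi> M N \<and> smooth_on (inv_into M \<phi>) N"


section \<open>Pseudo-Riemannian metrics on open subsets of Euclidean space\<close>

text \<open>
  A metric on an open set \<open>M\<close> of \<open>\<real>\<^sup>n\<close> is given by its matrix of components
  \<open>g p $ i $ j = g\<^sub>p(\<partial>\<^sub>i, \<partial>\<^sub>j)\<close>; all tangent spaces are identified with \<open>real ^ 'n\<close> through the
  coordinate frame. Only the values of \<open>g\<close> on \<open>M\<close> matter.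
\<close>

definition metric_form :: "(real^'n \<Rightarrow> real^'n^'n) \<Rightarrow> real^'n \<Rightarrow> real^'n \<Rightarrow> real^'n \<Rightarrow> real" where
  "metric_form g p v w = (\<Sum>i\<in>UNIV. \<Sum>j\<in>UNIV. g p $ i $ j * v $ i * w $ j)"

definition pseudo_riemannian_manifold :: "(real^'n) set \<Rightarrow> (real^'n \<Rightarrow> real^'n^'n) \<Rightarrow> bool" where
  "pseudo_riemannian_manifold M g \<longleftrightarrow>
     open M \<and> smooth_on g M \<and> (\<forall>p\<in>M. transpose (g p) = g p \<and> invertible (g p))"

definition riemannian_manifold :: "(real^'n) set \<Rightarrow> (real^'n \<Rightarrow> real^'n^'n) \<Rightarrow> bool" where
  "riemannian_manifold M g \<longleftrightarrow>
     pseudo_riemannian_manifold M g \<and> (\<forall>p\<in>M. \<forall>v. v \<noteq> 0 \<longrightarrow> metric_form g p v v > 0)"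

definition isometry ::
  "(real^'m) set \<Rightarrow> (real^'m \<Rightarrow> real^'m^'m) \<Rightarrow> (real^'n) set \<Rightarrow> (real^'n \<Rightarrow> real^'n^'n)
    \<Rightarrow> (real^'m \<Rightarrow> real^'n) \<Rightarrow> bool" where
  "isometry M g N h \<phi> \<longleftrightarrow>
     diffeomorphism M N \<phi> \<and>
     (\<forall>p\<in>M. \<forall>v w. metric_form h (\<phi> p) (frechet_derivative \<phi> (at p) v) (frechet_derivative \<phi> (at p) w)
                     = metric_form g p v w)"

definition isometric ::
  "(real^'m) set \<Rightarrow> (real^'m \<Rightarrow> real^'m^'m) \<Rightarrow> (real^'n) set \<Rightarrow> (real^'n \<Rightarrow> real^'n^'n) \<Rightarrow> bool" where
  "isometric M g N h \<longleftrightarrow> (\<exists>\<phi>. isometry M g N h \<phi>)"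


section \<open>Levi-Civita connection and curvature\<close>

definition metric_partial :: "(real^'n \<Rightarrow> real^'n^'n) \<Rightarrow> real^'n \<Rightarrow> 'n \<Rightarrow> 'n \<Rightarrow> 'n \<Rightarrow> real" where
  "metric_partial g p k i j = frechet_derivative (\<lambda>x. g x $ i $ j) (at p) (axis k 1)"

text \<open>
  The Christoffel symbols: \<open>\<nabla>\<^bsub>\<partial>\<^sub>i\<^esub> \<partial>\<^sub>j = (\<Sum>k. christoffel g p i j k \<partial>\<^sub>k)\<close>.
  The lemma \<open>levi_civita_unique\<close> below confirms that these are the coefficients of
  the torsion-free metric connection.
\<close>

definition christoffel :: "(real^'n \<Rightarrow> real^'n^'n) \<Rightarrow> real^'n \<Rightarrow> 'n \<Rightarrow> 'n \<Rightarrow> 'n \<Rightarrow> real" where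
  "christoffel g p i j k =
     (\<Sum>l\<in>UNIV. matrix_inv (g p) $ k $ l *
        (metric_partial g p i j l + metric_partial g p j i l - metric_partial g p l i j)) / 2"

lemma levi_civita_unique:
  fixes g :: "real^'n \<Rightarrow> real^'n^'n" and \<Gamma> :: "'n \<Rightarrow> 'n \<Rightarrow> 'n \<Rightarrow> real"
  assumes M: "pseudo_riemannian_manifold M g" and p: "p \<in> M"
  shows "(\<forall>i j k. \<Gamma> i j k = \<Gamma> j i k) \<and>
         (\<forall>i j k. metric_partial g p k i j =
            (\<Sum>l\<in>UNIV. \<Gamma> k i l * g p $ l $ j) + (\<Sum>l\<in>UNIV. \<Gamma> k j l * g p $ i $ l))
     \<longleftrightarrow> \<Gamma> = christoffel g p"
proof -
  have tr: "g x $ i $ j = g x $ j $ i" if "x \<in> M" for x i j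
  proof -
    have "transpose (g x) $ j $ i = g x $ j $ i"
      using M that by (simp add: pseudo_riemannian_manifold_def)
    then show ?thesis
      by (simp add: transpose_def)
  qed
  have inv: "invertible (g p)" and opn: "open M"
    using M p by (auto simp: pseudo_riemannian_manifold_def)
  have "Ck_on (Suc 0) g M"
    using M unfolding pseudo_riemannian_manifold_def smooth_on_def by blast
  then have "g differentiable_on M"
    unfolding Ck_on.simps by blast
  then have dg: "g differentiable (at p)"
    using opn p by (simp add: differentiable_on_eq_differentiable_at)
  have ij: "(\<lambda>x. g x $ i $ j) differentiable (at p)" for i j
  proof -
    obtain D where D: "(g has_derivative D) (at p)"
      using dg by (auto simp: differentiable_def)
    have "((\<lambda>x. g x $ i $ j) has_derivative (\<lambda>v. D v $ i $ j)) (at p)"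
      using bounded_linear.has_derivative[OF bounded_linear_vec_nth
              bounded_linear.has_derivative[OF bounded_linear_vec_nth D]] .
    then show ?thesis by (auto simp: differentiable_def)
  qed
  have sym: "metric_partial g p k i j = metric_partial g p k j i" for i j k
    unfolding metric_partial_def
    by (rule fun_cong[OF frechet_derivative_transform_within_open[OF ij opn p]]) (rule tr)
  let ?L = "\<lambda>\<Gamma> i j m. \<Sum>l\<in>UNIV. \<Gamma> i j l * g p $ l $ m"
  let ?K = "\<lambda>i j m. (metric_partial g p i j m + metric_partial g p j i m - metric_partial g p m i j) / 2"
  have right: "matrix_inv (g p) ** g p = mat 1" and left: "g p ** matrix_inv (g p) = mat 1"
    using someI_ex[OF inv[unfolded invertible_def]] unfolding matrix_inv_def by auto
  have ch: "christoffel g p i j k = (matrix_inv (g p) *v (\<chi> m. ?K i j m)) $ k" for i j k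
    unfolding christoffel_def matrix_vector_mult_def
    by (simp add: sum_divide_distrib)
  have gv: "?L \<Gamma> i j m = (g p *v (\<chi> l. \<Gamma> i j l)) $ m" for \<Gamma> :: "'n \<Rightarrow> 'n \<Rightarrow> 'n \<Rightarrow> real" and i j m
    unfolding matrix_vector_mult_def using tr[OF p] by (simp add: mult.commute)
  have key: "\<Gamma> = christoffel g p \<longleftrightarrow> (\<forall>i j m. ?L \<Gamma> i j m = ?K i j m)"
  proof
    assume *: "\<Gamma> = christoffel g p"
    show "\<forall>i j m. ?L \<Gamma> i j m = ?K i j m"
    proof (intro allI)
      fix i j m
      have "(\<chi> l. \<Gamma> i j l) = matrix_inv (g p) *v (\<chi> m. ?K i j m)"
        unfolding * ch by (simp add: vec_eq_iff)
      then have "?L \<Gamma> i j m = (g p *v (matrix_inv (g p) *v (\<chi> m. ?K i j m))) $ m"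
        unfolding gv by simp
      also have "\<dots> = ?K i j m"
        by (simp only: matrix_vector_mul_assoc left matrix_vector_mul_lid vec_lambda_beta)
      finally show "?L \<Gamma> i j m = ?K i j m" .
    qed
  next
    assume *: "\<forall>i j m. ?L \<Gamma> i j m = ?K i j m"
    show "\<Gamma> = christoffel g p"
    proof (intro ext)
      fix i j k
      have "(\<chi> m. ?K i j m) = g p *v (\<chi> l. \<Gamma> i j l)"
        using * unfolding gv by (simp add: vec_eq_iff)
      then have "christoffel g p i j k = (matrix_inv (g p) *v (g p *v (\<chi> l. \<Gamma> i j l))) $ k"
        unfolding ch by simp
      also have "\<dots> = \<Gamma> i j k"
        by (simp only: matrix_vector_mul_assoc right matrix_vector_mul_lid vec_lambda_beta)
      finally show "\<Gamma> i j k = christoffel g p i j k" by simp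
    qed
  qed
  have swap: "(\<Sum>l\<in>UNIV. \<Gamma> k j l * g p $ i $ l) = ?L \<Gamma> k j i" for i j k
    using tr[OF p] by simp
  show ?thesis
    unfolding swap
  proof
    assume *: "(\<forall>i j k. \<Gamma> i j k = \<Gamma> j i k) \<and>
               (\<forall>i j k. metric_partial g p k i j = ?L \<Gamma> k i j + ?L \<Gamma> k j i)"
    then have s: "?L \<Gamma> i j m = ?L \<Gamma> j i m" for i j m
      by (intro sum.cong refl arg_cong2[where f = "(*)"]) blast+
    show "\<Gamma> = christoffel g p"
      unfolding key
    proof (intro allI)
      fix i j m
      show "?L \<Gamma> i j m = ?K i j m"
        using *[THEN conjunct2, rule_format, of i j m] *[THEN conjunct2, rule_format, of j i m]
          *[THEN conjunct2, rule_format, of m i j] s[of i j m] s[of i m j] s[of j m i]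
        by simp
    qed
  next
    assume *: "\<Gamma> = christoffel g p"
    then have L: "?L \<Gamma> i j m = ?K i j m" for i j m
      using key by blast
    have "\<Gamma> i j k = \<Gamma> j i k" for i j k
      unfolding * ch using sym by (simp add: add.commute)
    moreover have "metric_partial g p k i j = ?L \<Gamma> k i j + ?L \<Gamma> k j i" for i j k
      unfolding L using sym[of k i j] by (simp add: field_simps)
    ultimately show "(\<forall>i j k. \<Gamma> i j k = \<Gamma> j i k) \<and>
               (\<forall>i j k. metric_partial g p k i j = ?L \<Gamma> k i j + ?L \<Gamma> k j i)"
      by blast
  qed
qed

definition cov_deriv ::
  "(real^'n \<Rightarrow> real^'n^'n) \<Rightarrow> (real^'n \<Rightarrow> real^'n) \<Rightarrow> (real^'n \<Rightarrow> real^'n) \<Rightarrow> real^'n \<Rightarrow> real^'n" where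
  "cov_deriv g X Y p = frechet_derivative Y (at p) (X p) +
     (\<chi> k. \<Sum>i\<in>UNIV. \<Sum>j\<in>UNIV. christoffel g p i j k * X p $ i * Y p $ j)"

text \<open>
  \<open>\<R>(x, y) z\<close> at \<open>p\<close>. The curvature is tensorial, so the tangent vectors may be extended by any
  vector fields; the constant (coordinate) extensions are used, and their Lie bracket vanishes, so
  that \<open>\<R>(X, Y) Z = \<nabla>\<^sub>X \<nabla>\<^sub>Y Z - \<nabla>\<^sub>Y \<nabla>\<^sub>X Z - \<nabla>\<^bsub>[X,Y]\<^esub> Z\<close> loses its last term.
\<close>

definition curvature_operator ::
  "(real^'n \<Rightarrow> real^'n^'n) \<Rightarrow> real^'n \<Rightarrow> real^'n \<Rightarrow> real^'n \<Rightarrow> real^'n \<Rightarrow> real^'n" where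
  "curvature_operator g p x y z =
     cov_deriv g (\<lambda>_. x) (cov_deriv g (\<lambda>_. y) (\<lambda>_. z)) p -
     cov_deriv g (\<lambda>_. y) (cov_deriv g (\<lambda>_. x) (\<lambda>_. z)) p"

definition curvature_tensor ::
  "(real^'n \<Rightarrow> real^'n^'n) \<Rightarrow> real^'n \<Rightarrow> real^'n \<Rightarrow> real^'n \<Rightarrow> real^'n \<Rightarrow> real^'n \<Rightarrow> real" where
  "curvature_tensor g p x y z w = metric_form g p (curvature_operator g p x y z) w"

text \<open>
  In an orthonormal frame of a Riemannian metric this is \<open>\<Sum>i j. R(e\<^sub>i, e\<^sub>j, e\<^sub>j, e\<^sub>i)\<close>. With the sign
  convention above, the unit round 2-sphere has scalar curvature \<open>+2\<close>.
\<close>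

definition scalar_curvature :: "(real^'n \<Rightarrow> real^'n^'n) \<Rightarrow> real^'n \<Rightarrow> real" where
  "scalar_curvature g p =
     (\<Sum>i\<in>UNIV. \<Sum>j\<in>UNIV. \<Sum>k\<in>UNIV. \<Sum>l\<in>UNIV.
        matrix_inv (g p) $ i $ l * matrix_inv (g p) $ j $ k *
        curvature_tensor g p (axis i 1) (axis j 1) (axis k 1) (axis l 1))"

definition skew_tsankov :: "(real^'n) set \<Rightarrow> (real^'n \<Rightarrow> real^'n^'n) \<Rightarrow> bool" where
  "skew_tsankov M g \<longleftrightarrow>
     (\<forall>p\<in>M. \<forall>x1 x2 x3 x4.
        curvature_operator g p x1 x2 \<circ> curvature_operator g p x3 x4 =
        curvature_operator g p x3 x4 \<circ> curvature_operator g p x1 x2)"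


section \<open>Local reducibility\<close>

text \<open>
  The Euclidean space \<open>real ^ 'n\<close> is split into the coordinate subspaces of the index sets \<open>I\<close> and
  \<open>- I\<close>; both have positive dimension if \<open>I\<close> is neither empty nor everything. Accordingly,
  \<open>split_domain I A B\<close> is the Cartesian product of \<open>A\<close> (intersected with the first subspace) and
  \<open>B\<close> (intersected with the second), and \<open>split_metric I g1 g2\<close> is the orthogonal sum of the metric
  \<open>g1\<close> on the first factor and \<open>g2\<close> on the second.
\<close>

definition coord_proj :: "'n set \<Rightarrow> real^'n \<Rightarrow> real^'n" where
  "coord_proj I x = (\<chi> i. if i \<in> I then x $ i else 0)"

definition split_domain :: "'n set \<Rightarrow> (real^'n) set \<Rightarrow> (real^'n) set \<Rightarrow> (real^'n) set" where
  "split_domain I A B = {x. coord_proj I x \<in> A \<and> coord_proj (- I) x \<in> B}"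

definition split_metric ::
  "'n set \<Rightarrow> (real^'n \<Rightarrow> real^'n^'n) \<Rightarrow> (real^'n \<Rightarrow> real^'n^'n) \<Rightarrow> real^'n \<Rightarrow> real^'n^'n" where
  "split_metric I g1 g2 x = (\<chi> i j.
     if i \<in> I \<and> j \<in> I then g1 (coord_proj I x) $ i $ j
     else if i \<notin> I \<and> j \<notin> I then g2 (coord_proj (- I) x) $ i $ j
     else 0)"

text \<open>
  The factors of the product decomposition are taken to be coordinate domains. This is no
  restriction: the two factor manifolds may be shrunk to coordinate neighbourhoods of the
  components of \<open>P\<close>, which shrinks the neighbourhood \<open>U\<close> of \<open>P\<close>.
\<close>

definition reducible_at :: "(real^'n) set \<Rightarrow> (real^'n \<Rightarrow> real^'n^'n) \<Rightarrow> real^'n \<Rightarrow> bool" where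
  "reducible_at M g P \<longleftrightarrow>
     (\<exists>U (I :: 'n set) A B g1 g2.
        open U \<and> P \<in> U \<and> U \<subseteq> M \<and> I \<noteq> {} \<and> I \<noteq> UNIV \<and>
        pseudo_riemannian_manifold (split_domain I A B) (split_metric I g1 g2) \<and>
        isometric U g (split_domain I A B) (split_metric I g1 g2))"

definition irreducible_manifold :: "(real^'n) set \<Rightarrow> (real^'n \<Rightarrow> real^'n^'n) \<Rightarrow> bool" where
  "irreducible_manifold M g \<longleftrightarrow> (\<forall>P\<in>M. \<not> reducible_at M g P)"


section \<open>The manifolds \<open>\<M>\<^sub>\<beta>\<close>\<close>

definition quadrant :: "(real^4) set" where
  "quadrant = {x. x $ 3 > 0 \<and> x $ 4 > 0}"

definition g_beta :: "real \<Rightarrow> real^4 \<Rightarrow> real^4^4" where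
  "g_beta \<beta> x = (\<chi> i j.
     if i \<noteq> j then 0
     else if i = 1 then (x $ 3)\<^sup>2
     else if i = 2 then (x $ 3 + \<beta> * x $ 4)\<^sup>2
     else 1)"

end

theory Submission
  imports Defs
begin

text \<open>
  Write \<open>a = x\<^sub>3\<close> and \<open>b = x\<^sub>3 + \<beta> x\<^sub>4\<close>, so that the metric is
  \<open>a\<^sup>2 dx\<^sub>1\<^sup>2 + b\<^sup>2 dx\<^sub>2\<^sup>2 + dx\<^sub>3\<^sup>2 + dx\<^sub>4\<^sup>2\<close>. Since \<open>a\<close> and \<open>b\<close> are affine functions on the flat
  \<open>(x\<^sub>3, x\<^sub>4)\<close>-plane, their Hessians vanish there, and the only surviving curvature is that of the planes
  spanned by \<open>\<partial>\<^sub>1\<close> and \<open>\<partial>\<^sub>2\<close>, whose sectional curvature is \<open>- <grad a, grad b> / (a b) = - 1 / (a b)\<close>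
  (\<open>g_beta_curvature\<close>). Every curvature operator is thus a multiple of one and the same operator, which
  gives the skew Tsankov property, and the scalar curvature is \<open>- 2 / (a b)\<close>.

  Both negative statements rest on the invariance of the connection and of the curvature under
  isometries (\<open>connection_natural\<close>, \<open>curvature_natural\<close>). The first follows from the uniqueness of the
  Levi-Civita connection; the second is the integrability condition of the first, obtained from the
  symmetry of the third derivatives of the isometry.

  Irreducibility. In a product the orthogonal projection onto the first factor is a self-adjoint,
  parallel field of endomorphisms that commutes with all curvature operators and is nowhere a multiple
  of the identity; an isometry carries it over to a field \<open>E\<close> with the same properties
  (\<open>reducible_imp_parallel_endomorphism\<close>). For the metric above, the curvature operators are
  multiples of a rotation of the plane of \<open>\<partial>\<^sub>1\<close> and \<open>\<partial>\<^sub>2\<close> with kernel spanned by \<open>\<partial>\<^sub>3\<close> and \<open>\<partial>\<^sub>4\<close>; a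
  self-adjoint \<open>E\<close> that commutes with it preserves these two planes and is a scalar \<open>c\<close> on the first
  one. As \<open>E\<close> is parallel and \<open>\<nabla>\<close> mixes the two planes (\<open>\<nabla>\<^bsub>\<partial>\<^sub>1\<^esub> \<partial>\<^sub>1 = - a \<partial>\<^sub>3\<close>,
  \<open>\<nabla>\<^bsub>\<partial>\<^sub>2\<^esub> \<partial>\<^sub>2 = - b \<partial>\<^sub>3 - \<beta> b \<partial>\<^sub>4\<close>), it is the same scalar on the second plane, a contradiction. The last
  step uses \<open>\<beta> \<noteq> 0\<close>.

  Non-isometry. By the above, \<open>u = a b\<close> is an isometry invariant: \<open>- 1 / u\<close> is the least sectional
  curvature at a point. Hence \<open>|grad u|\<^sup>2 / u = ((a + b)\<^sup>2 + \<beta>\<^sup>2 a\<^sup>2) / (a b) = 2 + (1 + \<beta>\<^sup>2) (a / b) + b / a\<close> is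
  one as well. Its minimum, \<open>2 + 2 \<surd>(1 + \<beta>\<^sup>2)\<close>, is attained on the quadrant and determines \<open>\<beta> > 0\<close>.
\<close>

section \<open>Second derivatives\<close>

lemma has_derivative_frechet_derivativeI:
  "(f has_derivative f') F \<Longrightarrow> (f has_derivative frechet_derivative f F) F"
  using differentiableI frechet_derivative_works by blast

text \<open>
  By the mean value theorem in the direction \<open>u\<close>, the second difference of \<open>f\<close> along \<open>t u\<close> and \<open>t v\<close> is
  \<open>t\<close> times a difference of two values of the directional derivative along \<open>u\<close>, taken at points that
  differ by \<open>t v\<close>. As the second difference is symmetric in \<open>u\<close> and \<open>v\<close>, its limit yields Young's form of
  the symmetry of second derivatives.
\<close>

lemma second_difference_tendsto:
  fixes f :: "'a::real_normed_vector \<Rightarrow> real"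
  assumes S: "open S" "p \<in> S"
    and f: "\<And>x. x \<in> S \<Longrightarrow> (f has_derivative f' x) (at x)"
    and A: "((\<lambda>x. f' x u) has_derivative A) (at p)"
  shows "((\<lambda>t. (f (p + t *\<^sub>R u + t *\<^sub>R v) - f (p + t *\<^sub>R u) - f (p + t *\<^sub>R v) + f p) / t\<^sup>2)
            \<longlongrightarrow> A v) (at_right 0)"
proof (rule tendstoI)
  fix e :: real
  assume e: "e > 0"
  define K where "K = 2 * norm u + norm v + 1"
  have K: "K > 0"
    unfolding K_def using norm_ge_zero[of u] norm_ge_zero[of v] by linarith
  define e' where "e' = e / (2 * K)"
  have e': "e' > 0" "e' * K < e"
    using e K by (auto simp: e'_def)
  obtain d where d: "d > 0"
    "\<And>y. norm (y - p) < d \<Longrightarrow> norm (f' y u - f' p u - A (y - p)) \<le> e' * norm (y - p)"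
    using A e'(1) unfolding has_derivative_at_alt by meson
  obtain r where r: "r > 0" "ball p r \<subseteq> S"
    using S open_contains_ball by blast
  have linA: "linear A"
    using A has_derivative_linear by blast
  have ev: "eventually (\<lambda>t::real. t \<in> {0<..<min d r / K}) (at_right 0)"
    using d(1) r(1) K by (intro eventually_at_right_real) simp
  show "eventually (\<lambda>t. dist ((f (p + t *\<^sub>R u + t *\<^sub>R v) - f (p + t *\<^sub>R u) - f (p + t *\<^sub>R v) + f p) / t\<^sup>2)
          (A v) < e) (at_right 0)"
    using ev
  proof (rule eventually_mono)
    fix t :: real
    assume "t \<in> {0<..<min d r / K}"
    then have t: "0 < t" "t * K < d" "t * K < r"
      using K by (auto simp: field_simps)
    have near: "norm (s *\<^sub>R u + c *\<^sub>R v) \<le> t * (norm u + norm v)" if "s \<in> {0..t}" "c \<in> {0..t}" for s c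
      using that by (intro order_trans[OF norm_triangle_ineq])
        (auto simp: distrib_left intro!: add_mono mult_right_mono)
    have near': "norm (s *\<^sub>R u + c *\<^sub>R v) < t * K" if "s \<in> {0..t}" "c \<in> {0..t}" for s c
    proof -
      have "t * (norm u + norm v) < t * K"
        using t(1) norm_ge_zero[of u] unfolding K_def
        by (intro mult_strict_left_mono) linarith+
      then show ?thesis using near[OF that] by linarith
    qed
    have inS: "p + s *\<^sub>R u + c *\<^sub>R v \<in> S" if "s \<in> {0..t}" "c \<in> {0..t}" for s c
    proof -
      have "dist p (p + s *\<^sub>R u + c *\<^sub>R v) = norm (s *\<^sub>R u + c *\<^sub>R v)"
        unfolding dist_norm norm_minus_commute[of p] by (simp add: add.assoc)
      then show ?thesis
        using near'[OF that] t(3) r(2) by auto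
    qed
    \<comment> \<open>The difference in the direction \<open>v\<close>, as a function of the step \<open>s\<close> in the direction \<open>u\<close>.\<close>
    define F where "F s = f (p + s *\<^sub>R u + t *\<^sub>R v) - f (p + s *\<^sub>R u)" for s
    have der: "((\<lambda>s. f (p + s *\<^sub>R u + c *\<^sub>R v)) has_derivative
            (\<lambda>h. h * f' (p + s *\<^sub>R u + c *\<^sub>R v) u)) (at s)" if "s \<in> {0..t}" "c \<in> {0..t}" for s c
    proof -
      have D: "(f has_derivative f' (p + s *\<^sub>R u + c *\<^sub>R v)) (at (p + s *\<^sub>R u + c *\<^sub>R v))"
        using f inS[OF that] by blast
      have "((\<lambda>s. p + s *\<^sub>R u + c *\<^sub>R v) has_derivative (\<lambda>h. h *\<^sub>R u)) (at s)"
        by (auto intro!: derivative_eq_intros)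
      from has_derivative_compose[OF this D] show ?thesis
        using linear_scale[OF has_derivative_linear[OF D]] by simp
    qed
    have derF: "(F has_derivative
         (\<lambda>h. h * (f' (p + s *\<^sub>R u + t *\<^sub>R v) u - f' (p + s *\<^sub>R u) u))) (at s)"
      if "s \<in> {0..t}" for s
    proof -
      have "((\<lambda>s. f (p + s *\<^sub>R u + t *\<^sub>R v) - f (p + s *\<^sub>R u + 0 *\<^sub>R v)) has_derivative
          (\<lambda>h. h * f' (p + s *\<^sub>R u + t *\<^sub>R v) u - h * f' (p + s *\<^sub>R u + 0 *\<^sub>R v) u)) (at s)"
        using t(1) that by (intro has_derivative_diff der) auto
      then show ?thesis
        unfolding F_def right_diff_distrib by simp
    qed
    have "\<exists>s\<in>{0<..<t}. F t - F 0 = (t - 0) * (f' (p + s *\<^sub>R u + t *\<^sub>R v) u - f' (p + s *\<^sub>R u) u)"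
      by (rule mvt_simple[OF t(1)]) (rule has_derivative_at_withinI[OF derF], simp)
    then obtain s where s: "0 < s" "s < t"
      and Fs: "F t - F 0 = t * (f' (p + s *\<^sub>R u + t *\<^sub>R v) u - f' (p + s *\<^sub>R u) u)"
      by auto
    let ?y = "p + s *\<^sub>R u + t *\<^sub>R v" and ?z = "p + s *\<^sub>R u"
    have y: "norm (f' ?y u - f' p u - A (s *\<^sub>R u + t *\<^sub>R v)) \<le> e' * (t * (norm u + norm v))"
    proof -
      have "norm (f' ?y u - f' p u - A (s *\<^sub>R u + t *\<^sub>R v)) \<le> e' * norm (s *\<^sub>R u + t *\<^sub>R v)"
        using d(2)[of ?y] near'[of s t] s t by (simp add: add.assoc)
      also have "\<dots> \<le> e' * (t * (norm u + norm v))"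
        using near[of s t] s t e' by (intro mult_left_mono) auto
      finally show ?thesis .
    qed
    have z: "norm (f' ?z u - f' p u - A (s *\<^sub>R u)) \<le> e' * (t * norm u)"
    proof -
      have "norm (f' ?z u - f' p u - A (s *\<^sub>R u)) \<le> e' * norm (s *\<^sub>R u)"
        using d(2)[of ?z] near'[of s 0] s t by simp
      also have "\<dots> \<le> e' * (t * norm u)"
        using s t e' by (intro mult_left_mono) (auto intro: mult_right_mono)
      finally show ?thesis .
    qed
    have "A (s *\<^sub>R u + t *\<^sub>R v) = A (s *\<^sub>R u) + t * A v"
      by (simp add: linear_add[OF linA] linear_scale[OF linA])
    then have "\<bar>(f' ?y u - f' ?z u) - t * A v\<bar> \<le> e' * (t * (norm u + norm v)) + e' * (t * norm u)"
      using y z unfolding real_norm_def by linarith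
    also have "\<dots> = t * (e' * (2 * norm u + norm v))"
      by (simp add: algebra_simps)
    also have "\<dots> \<le> t * (e' * K)"
      using t(1) e'(1) unfolding K_def by (intro mult_left_mono) auto
    also have "\<dots> < t * e"
      using t(1) e'(2) by simp
    finally have main: "\<bar>(f' ?y u - f' ?z u) - t * A v\<bar> < t * e" .
    have "(F t - F 0) / t\<^sup>2 - A v = ((f' ?y u - f' ?z u) - t * A v) / t"
      unfolding Fs using t(1) by (simp add: field_simps power2_eq_square)
    then have "\<bar>(F t - F 0) / t\<^sup>2 - A v\<bar> < e"
      using main t(1) by (simp only:) (simp add: abs_divide pos_divide_less_eq mult.commute)
    moreover have "f (p + t *\<^sub>R u + t *\<^sub>R v) - f (p + t *\<^sub>R u) - f (p + t *\<^sub>R v) + f p = F t - F 0"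
      by (simp add: F_def)
    ultimately show "dist ((f (p + t *\<^sub>R u + t *\<^sub>R v) - f (p + t *\<^sub>R u) - f (p + t *\<^sub>R v) + f p) / t\<^sup>2) (A v) < e"
      by (simp only: dist_real_def)
  qed
qed

lemma symmetric_second_derivative:
  fixes f :: "'a::real_normed_vector \<Rightarrow> 'b::euclidean_space"
  assumes S: "open S" "p \<in> S"
    and f: "\<And>x. x \<in> S \<Longrightarrow> (f has_derivative f' x) (at x)"
    and A: "((\<lambda>x. f' x u) has_derivative A) (at p)"
    and B: "((\<lambda>x. f' x v) has_derivative B) (at p)"
  shows "A v = B u"
proof (rule euclidean_eqI)
  fix b :: 'b
  assume "b \<in> Basis"
  have f1: "((\<lambda>x. f x \<bullet> b) has_derivative (\<lambda>w. f' x w \<bullet> b)) (at x)" if "x \<in> S" for x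
    by (rule has_derivative_inner_left[OF f[OF that]])
  have A1: "((\<lambda>x. f' x u \<bullet> b) has_derivative (\<lambda>w. A w \<bullet> b)) (at p)"
    and B1: "((\<lambda>x. f' x v \<bullet> b) has_derivative (\<lambda>w. B w \<bullet> b)) (at p)"
    by (rule has_derivative_inner_left[OF A], rule has_derivative_inner_left[OF B])
  have lA: "((\<lambda>t. (f (p + t *\<^sub>R u + t *\<^sub>R v) \<bullet> b - f (p + t *\<^sub>R u) \<bullet> b - f (p + t *\<^sub>R v) \<bullet> b + f p \<bullet> b) / t\<^sup>2)
            \<longlongrightarrow> A v \<bullet> b) (at_right 0)"
    by (rule second_difference_tendsto[OF S f1 A1])
  have lB: "((\<lambda>t. (f (p + t *\<^sub>R v + t *\<^sub>R u) \<bullet> b - f (p + t *\<^sub>R v) \<bullet> b - f (p + t *\<^sub>R u) \<bullet> b + f p \<bullet> b) / t\<^sup>2)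
            \<longlongrightarrow> B u \<bullet> b) (at_right 0)"
    by (rule second_difference_tendsto[OF S f1 B1])
  have swap: "p + t *\<^sub>R v + t *\<^sub>R u = p + t *\<^sub>R u + t *\<^sub>R v" for t
    by (simp add: add.assoc add.commute)
  have comm: "f x \<bullet> b - f (p + t *\<^sub>R v) \<bullet> b - f (p + t *\<^sub>R u) \<bullet> b = f x \<bullet> b - f (p + t *\<^sub>R u) \<bullet> b - f (p + t *\<^sub>R v) \<bullet> b" for x t
    by simp
  have "((\<lambda>t. (f (p + t *\<^sub>R u + t *\<^sub>R v) \<bullet> b - f (p + t *\<^sub>R u) \<bullet> b - f (p + t *\<^sub>R v) \<bullet> b + f p \<bullet> b) / t\<^sup>2)
            \<longlongrightarrow> B u \<bullet> b) (at_right 0)"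
    using lB unfolding swap comm .
  then show "A v \<bullet> b = B u \<bullet> b"
    by (rule tendsto_unique[OF trivial_limit_at_right_real lA])
qed

section \<open>Smooth maps\<close>

lemma smooth_on_subset: "smooth_on f S \<Longrightarrow> T \<subseteq> S \<Longrightarrow> smooth_on f T"
proof -
  have "Ck_on k f S \<Longrightarrow> T \<subseteq> S \<Longrightarrow> Ck_on k f T" for k
  proof (induction k arbitrary: f)
    case 0
    then show ?case
      by (auto intro: continuous_on_subset)
  next
    case (Suc k)
    then show ?case
      unfolding Ck_on.simps using differentiable_on_subset by blast
  qed
  then show "smooth_on f S \<Longrightarrow> T \<subseteq> S \<Longrightarrow> smooth_on f T"
    unfolding smooth_on_def by blast
qed

lemma smooth_on_differentiable_at:
  assumes "smooth_on f S" "open S" "p \<in> S"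
  shows "f differentiable (at p)"
proof -
  have "Ck_on (Suc 0) f S"
    using assms(1) unfolding smooth_on_def by blast
  then show ?thesis
    using assms by (auto simp: differentiable_on_eq_differentiable_at)
qed

lemma smooth_on_has_derivative:
  assumes "smooth_on f S" "open S" "p \<in> S"
  shows "(f has_derivative frechet_derivative f (at p)) (at p)"
  using smooth_on_differentiable_at[OF assms] by (simp add: frechet_derivative_works)

lemma smooth_on_partial:
  assumes "smooth_on f S" "b \<in> Basis"
  shows "smooth_on (\<lambda>x. frechet_derivative f (at x) b) S"
  unfolding smooth_on_def
proof
  fix k
  have "Ck_on (Suc k) f S"
    using assms(1) unfolding smooth_on_def by blast
  then show "Ck_on k (\<lambda>x. frechet_derivative f (at x) b) S"
    using assms(2) unfolding Ck_on.simps by blast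
qed

lemma linear_eq_sum_Basis:
  fixes L :: "'a::euclidean_space \<Rightarrow> 'b::real_vector"
  assumes "linear L"
  shows "L v = (\<Sum>b\<in>Basis. (v \<bullet> b) *\<^sub>R L b)"
proof -
  have "L v = L (\<Sum>b\<in>Basis. (v \<bullet> b) *\<^sub>R b)"
    by (simp add: euclidean_representation)
  then show ?thesis
    by (simp add: linear_sum[OF assms] linear_scale[OF assms])
qed

text \<open>
  Smoothness only speaks of derivatives along basis vectors; on an open set the derivative along any
  vector is a fixed linear combination of those, hence differentiable again.
\<close>

lemma smooth_on_directional_expansion:
  fixes f :: "'a::euclidean_space \<Rightarrow> 'b::real_normed_vector"
  assumes "smooth_on f S" "open S" "x \<in> S"
  shows "frechet_derivative f (at x) v = (\<Sum>b\<in>Basis. (v \<bullet> b) *\<^sub>R frechet_derivative f (at x) b)"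
  by (rule linear_eq_sum_Basis)
    (rule linear_frechet_derivative[OF smooth_on_differentiable_at[OF assms]])

lemma smooth_on_directional_has_derivative:
  fixes f :: "'a::euclidean_space \<Rightarrow> 'b::real_normed_vector"
  assumes f: "smooth_on f S" "open S" "p \<in> S"
  shows "((\<lambda>x. frechet_derivative f (at x) v) has_derivative
    frechet_derivative (\<lambda>x. frechet_derivative f (at x) v) (at p)) (at p)"
proof -
  have "((\<lambda>x. \<Sum>b\<in>Basis. (v \<bullet> b) *\<^sub>R frechet_derivative f (at x) b) has_derivative
      (\<lambda>w. \<Sum>b\<in>Basis. (v \<bullet> b) *\<^sub>R frechet_derivative (\<lambda>x. frechet_derivative f (at x) b) (at p) w)) (at p)"
    using f by (intro has_derivative_sum has_derivative_scaleR_right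
        smooth_on_has_derivative[where S = S] smooth_on_partial)
  then show ?thesis
    by (intro has_derivative_frechet_derivativeI, rule has_derivative_transform_within_open[OF _ f(2,3)])
      (simp add: smooth_on_directional_expansion[OF f(1,2), of _ v, symmetric])
qed

lemma smooth_on_second_derivative_symmetric:
  fixes f :: "'a::euclidean_space \<Rightarrow> 'b::euclidean_space"
  assumes f: "smooth_on f S" "open S" "p \<in> S"
  shows "frechet_derivative (\<lambda>x. frechet_derivative f (at x) v) (at p) w =
    frechet_derivative (\<lambda>x. frechet_derivative f (at x) w) (at p) v"
  by (rule symmetric_second_derivative[OF f(2,3) smooth_on_has_derivative[OF f(1,2)]
        smooth_on_directional_has_derivative[OF f] smooth_on_directional_has_derivative[OF f]])

lemma smooth_on_linear:
  fixes L :: "'a::euclidean_space \<Rightarrow> 'b::real_normed_vector"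
  assumes "linear L"
  shows "smooth_on (\<lambda>x. c + L x) S"
proof -
  have const: "Ck_on k (\<lambda>x::'a. c) S" for k and c :: 'b
    by (induction k arbitrary: c) (simp_all add: differentiable_on_def)
  have D: "((\<lambda>x. c + L x) has_derivative L) (at x within T)" for x T
    using has_derivative_add[OF has_derivative_const linear_imp_has_derivative[OF assms]] by simp
  have fd: "frechet_derivative (\<lambda>x. c + L x) (at x) = L" for x
    using frechet_derivative_at[OF D] by simp
  have "Ck_on k (\<lambda>x. c + L x) S" for k
  proof (cases k)
    case 0
    then show ?thesis using has_derivative_continuous_on[OF D] by simp
  next
    case (Suc j)
    then show ?thesis
      using const differentiable_on_def[THEN iffD2, OF ballI, OF differentiableI[OF D]] by (simp add: fd)
  qed
  then show ?thesis unfolding smooth_on_def by blast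
qed

text \<open>
  The directional derivatives of a quadratic map are linear, so smoothness is reduced to that of linear
  maps; the components of the metrics below are of this kind.
\<close>

lemma smooth_on_quadratic:
  fixes B :: "'a::euclidean_space \<Rightarrow> 'a \<Rightarrow> 'b::real_normed_vector"
  assumes B: "bilinear B"
  shows "smooth_on (\<lambda>x. c + B x x) S"
proof -
  have bb: "bounded_bilinear B"
    using B by (simp add: bilinear_conv_bounded_bilinear)
  have D: "((\<lambda>x. c + B x x) has_derivative (\<lambda>h. B x h + B h x)) (at x within T)" for x T
    using has_derivative_add[OF has_derivative_const
        bounded_bilinear.FDERIV[OF bb has_derivative_ident has_derivative_ident]]
    by simp
  have fd: "frechet_derivative (\<lambda>x. c + B x x) (at x) = (\<lambda>h. B x h + B h x)" for x
    using frechet_derivative_at[OF D] by simp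
  have L: "linear (\<lambda>x. B x b + B b x)" for b
    using B by (intro linear_compose_add) (auto simp: bilinear_def)
  have "Ck_on k (\<lambda>x. c + B x x) S" for k
  proof (cases k)
    case 0
    then show ?thesis using has_derivative_continuous_on[OF D] by simp
  next
    case (Suc j)
    have "Ck_on j (\<lambda>x. B x b + B b x) S" for b
      using smooth_on_linear[OF L, of 0] unfolding smooth_on_def by simp
    then show ?thesis
      using Suc differentiable_on_def[THEN iffD2, OF ballI, OF differentiableI[OF D]] by (simp add: fd)
  qed
  then show ?thesis unfolding smooth_on_def by blast
qed

section \<open>Fields of bilinear maps\<close>

lemma bilinear_eq_sum_Basis:
  fixes B :: "'a::euclidean_space \<Rightarrow> 'b::euclidean_space \<Rightarrow> 'c::real_vector"
  assumes "bilinear B"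
  shows "B a b = (\<Sum>i\<in>Basis. \<Sum>j\<in>Basis. ((a \<bullet> i) * (b \<bullet> j)) *\<^sub>R B i j)"
proof -
  have L: "linear (\<lambda>a. B a b)" "linear (B i)" for i
    using assms by (auto simp: bilinear_def)
  have "B a b = (\<Sum>i\<in>Basis. (a \<bullet> i) *\<^sub>R B i b)"
    by (rule linear_eq_sum_Basis[OF L(1)])
  also have "\<dots> = (\<Sum>i\<in>Basis. (a \<bullet> i) *\<^sub>R (\<Sum>j\<in>Basis. (b \<bullet> j) *\<^sub>R B i j))"
    by (subst linear_eq_sum_Basis[OF L(2), where v = b]) simp
  finally show ?thesis
    by (simp add: scaleR_sum_right)
qed

text \<open>
  The product rule for a bilinear map that depends on the point. It is applied to metrics and to
  connections along a map \<open>\<phi>\<close>, and the dependence on the point is only assumed to be differentiable for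
  each fixed pair of arguments: in finite dimension that suffices, by expansion over the basis.
\<close>

lemma has_derivative_bilinear_field:
  fixes \<Gamma> :: "'m::real_normed_vector \<Rightarrow> 'a::euclidean_space \<Rightarrow> 'b::euclidean_space \<Rightarrow> 'c::real_normed_vector"
  assumes bil: "\<And>y. bilinear (\<Gamma> y)"
    and \<Gamma>: "\<And>a b. (\<lambda>y. \<Gamma> y a b) differentiable (at (\<phi> p))"
    and \<phi>: "(\<phi> has_derivative \<phi>') (at p)"
    and A: "(A has_derivative A') (at p)" and B: "(B has_derivative B') (at p)"
  shows "((\<lambda>x. \<Gamma> (\<phi> x) (A x) (B x)) has_derivative
      (\<lambda>v. frechet_derivative (\<lambda>y. \<Gamma> y (A p) (B p)) (at (\<phi> p)) (\<phi>' v)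
           + \<Gamma> (\<phi> p) (A' v) (B p) + \<Gamma> (\<phi> p) (A p) (B' v))) (at p)"
proof -
  let ?D = "\<lambda>i j. frechet_derivative (\<lambda>y. \<Gamma> y i j) (at (\<phi> p))"
  have D: "((\<lambda>y. \<Gamma> y i j) has_derivative ?D i j) (at (\<phi> p))" for i j
    using \<Gamma> by (simp add: frechet_derivative_works)
  have Dab: "?D a b w = (\<Sum>i\<in>Basis. \<Sum>j\<in>Basis. ((a \<bullet> i) * (b \<bullet> j)) *\<^sub>R ?D i j w)" for a b w
  proof -
    have "((\<lambda>y. \<Sum>i\<in>Basis. \<Sum>j\<in>Basis. ((a \<bullet> i) * (b \<bullet> j)) *\<^sub>R \<Gamma> y i j) has_derivative
        (\<lambda>w. \<Sum>i\<in>Basis. \<Sum>j\<in>Basis. ((a \<bullet> i) * (b \<bullet> j)) *\<^sub>R ?D i j w)) (at (\<phi> p))"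
      by (intro has_derivative_sum has_derivative_scaleR_right D)
    then have "((\<lambda>y. \<Gamma> y a b) has_derivative
        (\<lambda>w. \<Sum>i\<in>Basis. \<Sum>j\<in>Basis. ((a \<bullet> i) * (b \<bullet> j)) *\<^sub>R ?D i j w)) (at (\<phi> p))"
      unfolding bilinear_eq_sum_Basis[OF bil, symmetric] .
    from frechet_derivative_at[OF this] show ?thesis
      by (rule fun_cong[OF sym])
  qed
  have comp: "((\<lambda>x. \<Gamma> (\<phi> x) i j) has_derivative (\<lambda>v. ?D i j (\<phi>' v))) (at p)" for i j
    by (rule has_derivative_compose[OF \<phi> D])
  have "((\<lambda>x. \<Sum>i\<in>Basis. \<Sum>j\<in>Basis. ((A x \<bullet> i) * (B x \<bullet> j)) *\<^sub>R \<Gamma> (\<phi> x) i j) has_derivative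
      (\<lambda>v. \<Sum>i\<in>Basis. \<Sum>j\<in>Basis. ((A p \<bullet> i) * (B p \<bullet> j)) *\<^sub>R ?D i j (\<phi>' v)
          + ((A p \<bullet> i) * (B' v \<bullet> j) + (A' v \<bullet> i) * (B p \<bullet> j)) *\<^sub>R \<Gamma> (\<phi> p) i j)) (at p)"
    by (intro has_derivative_sum has_derivative_scaleR has_derivative_mult
        has_derivative_inner_left A B comp)
  then have "((\<lambda>x. \<Gamma> (\<phi> x) (A x) (B x)) has_derivative
      (\<lambda>v. \<Sum>i\<in>Basis. \<Sum>j\<in>Basis. ((A p \<bullet> i) * (B p \<bullet> j)) *\<^sub>R ?D i j (\<phi>' v)
          + ((A p \<bullet> i) * (B' v \<bullet> j) + (A' v \<bullet> i) * (B p \<bullet> j)) *\<^sub>R \<Gamma> (\<phi> p) i j)) (at p)"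
    unfolding bilinear_eq_sum_Basis[OF bil, symmetric] .
  moreover have "(\<Sum>i\<in>Basis. \<Sum>j\<in>Basis. ((A p \<bullet> i) * (B p \<bullet> j)) *\<^sub>R ?D i j (\<phi>' v)
          + ((A p \<bullet> i) * (B' v \<bullet> j) + (A' v \<bullet> i) * (B p \<bullet> j)) *\<^sub>R \<Gamma> (\<phi> p) i j)
      = ?D (A p) (B p) (\<phi>' v) + \<Gamma> (\<phi> p) (A' v) (B p) + \<Gamma> (\<phi> p) (A p) (B' v)" for v
    unfolding Dab[of "A p" "B p"] bilinear_eq_sum_Basis[OF bil, of _ "A p" "B' v"]
      bilinear_eq_sum_Basis[OF bil, of _ "A' v" "B p"]
    by (simp add: sum.distrib scaleR_add_left)
  ultimately show ?thesis
    by simp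
qed

lemma trilinear_eq_on_axis:
  fixes f f' :: "real^'n \<Rightarrow> real^'n \<Rightarrow> real^'n \<Rightarrow> 'b::real_vector"
  assumes f: "\<And>v w. linear (\<lambda>u. f u v w)" "\<And>u w. linear (\<lambda>v. f u v w)" "\<And>u v. linear (f u v)"
    and f': "\<And>v w. linear (\<lambda>u. f' u v w)" "\<And>u w. linear (\<lambda>v. f' u v w)" "\<And>u v. linear (f' u v)"
    and eq: "\<And>k i j. f (axis k 1) (axis i 1) (axis j 1) = f' (axis k 1) (axis i 1) (axis j 1)"
  shows "f u v w = f' u v w"
proof -
  have B: "\<exists>i. b = axis i 1" if "b \<in> Basis" for b :: "real^'n"
    using that by (auto simp: Basis_vec_def)
  have 1: "f u v w = f' u v w" if "u \<in> Basis" "v \<in> Basis" for u v w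
    using linear_eq_stdbasis[OF f(3) f'(3)] eq B that by metis
  have 2: "f u v w = f' u v w" if "u \<in> Basis" for u v w
    using linear_eq_stdbasis[OF f(2) f'(2)] 1 that by metis
  show ?thesis
    using linear_eq_stdbasis[OF f(1) f'(1)] 2 by metis
qed

section \<open>The Levi-Civita connection\<close>

text \<open>
  The Christoffel symbols as a bilinear map: the covariant derivative at \<open>p\<close> of the constant vector
  field \<open>v\<close> in the direction \<open>u\<close>.
\<close>

definition connection_form :: "(real^'n \<Rightarrow> real^'n^'n) \<Rightarrow> real^'n \<Rightarrow> real^'n \<Rightarrow> real^'n \<Rightarrow> real^'n" where
  "connection_form g p u v = (\<chi> k. \<Sum>i\<in>UNIV. \<Sum>j\<in>UNIV. christoffel g p i j k * u $ i * v $ j)"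

lemma bilinear_double_sum:
  fixes c :: "'n::finite \<Rightarrow> 'n \<Rightarrow> real"
  shows "bilinear (\<lambda>u v::real^'n. \<Sum>i\<in>UNIV. \<Sum>j\<in>UNIV. c i j * u $ i * v $ j)"
  unfolding bilinear_def
  by (auto intro!: linearI simp: algebra_simps sum.distrib sum_distrib_left)

lemma bilinear_metric_form: "bilinear (metric_form g p)"
  unfolding metric_form_def by (rule bilinear_double_sum)

lemma linear_componentwise:
  fixes f :: "'a::real_vector \<Rightarrow> real^'n"
  assumes "\<And>k. linear (\<lambda>u. f u $ k)"
  shows "linear f"
  using assms unfolding linear_iff by (simp add: vec_eq_iff)

lemma bilinear_connection_form: "bilinear (connection_form g p)"
proof -
  have "bilinear (\<lambda>u v. connection_form g p u v $ k)" for k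
    unfolding connection_form_def vec_lambda_beta by (rule bilinear_double_sum)
  then show ?thesis
    unfolding bilinear_def by (auto intro: linear_componentwise)
qed

lemma double_sum_axis:
  fixes c :: "'n::finite \<Rightarrow> 'n \<Rightarrow> real" and v :: "real^'n"
  shows "(\<Sum>i\<in>UNIV. \<Sum>j\<in>UNIV. c i j * v $ i * axis m 1 $ j) = (\<Sum>i\<in>UNIV. c i m * v $ i)"
    and "(\<Sum>i\<in>UNIV. \<Sum>j\<in>UNIV. c i j * axis m 1 $ i * v $ j) = (\<Sum>j\<in>UNIV. c m j * v $ j)"
proof -
  show "(\<Sum>i\<in>UNIV. \<Sum>j\<in>UNIV. c i j * v $ i * axis m 1 $ j) = (\<Sum>i\<in>UNIV. c i m * v $ i)"
    by (simp add: axis_def if_distrib cong: if_cong)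
  have "(\<Sum>i\<in>UNIV. \<Sum>j\<in>UNIV. c i j * axis m 1 $ i * v $ j) =
      (\<Sum>i\<in>UNIV. if i = m then \<Sum>j\<in>UNIV. c m j * v $ j else 0)"
    by (intro sum.cong) (auto simp: axis_def)
  then show "(\<Sum>i\<in>UNIV. \<Sum>j\<in>UNIV. c i j * axis m 1 $ i * v $ j) = (\<Sum>j\<in>UNIV. c m j * v $ j)"
    by simp
qed

lemma metric_form_axis:
  "metric_form g p v (axis j 1) = (\<Sum>l\<in>UNIV. g p $ l $ j * v $ l)"
  "metric_form g p (axis i 1) v = (\<Sum>l\<in>UNIV. g p $ i $ l * v $ l)"
  "metric_form g p (axis i 1) (axis j 1) = g p $ i $ j"
proof -
  show 1: "metric_form g p v (axis j 1) = (\<Sum>l\<in>UNIV. g p $ l $ j * v $ l)" for v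
    unfolding metric_form_def by (rule double_sum_axis)
  show "metric_form g p (axis i 1) v = (\<Sum>l\<in>UNIV. g p $ i $ l * v $ l)"
    unfolding metric_form_def by (rule double_sum_axis)
  show "metric_form g p (axis i 1) (axis j 1) = g p $ i $ j"
    unfolding 1 by (simp add: axis_def if_distrib cong: if_cong)
qed

lemma connection_form_axis:
  "connection_form g p (axis i 1) (axis j 1) $ k = christoffel g p i j k"
  unfolding connection_form_def vec_lambda_beta double_sum_axis(1)
  by (simp add: axis_def if_distrib cong: if_cong)

lemma cov_deriv_eq:
  "cov_deriv g X Y p = frechet_derivative Y (at p) (X p) + connection_form g p (X p) (Y p)"
  by (simp add: cov_deriv_def connection_form_def)

lemma curvature_operator_eq:
  "curvature_operator g p x y z =
     (frechet_derivative (\<lambda>q. connection_form g q y z) (at p) x + connection_form g p x (connection_form g p y z)) -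
     (frechet_derivative (\<lambda>q. connection_form g q x z) (at p) y + connection_form g p y (connection_form g p x z))"
  by (simp add: curvature_operator_def cov_deriv_eq[abs_def])

subsection \<open>Differentiability of the connection\<close>

lemma matrix_inv_mult:
  fixes A :: "real^'n^'n"
  assumes "invertible A"
  shows "matrix_inv A ** A = mat 1" "A ** matrix_inv A = mat 1"
  using someI_ex[OF assms[unfolded invertible_def]] unfolding matrix_inv_def by auto

text \<open>
  Cramer's rule exhibits the entries of the inverse as rational functions of the entries, which is why
  the Christoffel symbols of a smooth metric are differentiable.
\<close>

lemma matrix_inv_cramer:
  fixes A :: "real^'n^'n"
  assumes A: "invertible A"
  shows "matrix_inv A $ k $ l = det (\<chi> i j. if j = k then axis l 1 $ i else A $ i $ j) / det A"
proof -
  have "A *v (matrix_inv A *v axis l 1) = axis l 1"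
    by (simp only: matrix_vector_mul_assoc matrix_inv_mult(2)[OF A] matrix_vector_mul_lid)
  moreover have "det A \<noteq> 0"
    using A by (simp add: invertible_det_nz)
  ultimately have "matrix_inv A *v axis l 1 =
      (\<chi> k. det (\<chi> i j. if j = k then axis l 1 $ i else A $ i $ j) / det A)"
    using cramer by blast
  then have "(matrix_inv A *v axis l 1) $ k = det (\<chi> i j. if j = k then axis l 1 $ i else A $ i $ j) / det A"
    by simp
  moreover have "(matrix_inv A *v axis l 1) $ k = matrix_inv A $ k $ l"
    by (simp add: matrix_vector_mult_def axis_def if_distrib cong: if_cong)
  ultimately show ?thesis
    by simp
qed

lemma differentiable_det:
  fixes A :: "'a::real_normed_vector \<Rightarrow> real^'n^'n"
  assumes "\<And>i j. (\<lambda>x. A x $ i $ j) differentiable (at p)"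
  shows "(\<lambda>x. det (A x)) differentiable (at p)"
proof -
  have pr: "(\<lambda>x. \<Prod>i\<in>UNIV. A x $ i $ \<pi> i) differentiable (at p)" for \<pi>
  proof -
    have "((\<lambda>x. A x $ i $ \<pi> i) has_derivative frechet_derivative (\<lambda>x. A x $ i $ \<pi> i) (at p)) (at p)" for i
      using assms by (simp add: frechet_derivative_works)
    from has_derivative_prod[OF this] show ?thesis
      by (rule differentiableI)
  qed
  show ?thesis
    unfolding det_def using pr by (auto intro!: derivative_intros finite_permutations)
qed

lemma differentiable_matrix_inv:
  fixes A :: "'a::real_normed_vector \<Rightarrow> real^'n^'n"
  assumes S: "open S" "p \<in> S" and inv: "\<And>x. x \<in> S \<Longrightarrow> invertible (A x)"
    and A: "\<And>i j. (\<lambda>x. A x $ i $ j) differentiable (at p)"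
  shows "(\<lambda>x. matrix_inv (A x) $ k $ l) differentiable (at p)"
proof -
  have "(\<lambda>x. if j = k then axis l 1 $ i else A x $ i $ j) differentiable (at p)" for i j
    using A by (cases "j = k") auto
  then have "(\<lambda>x. det (\<chi> i j. if j = k then axis l 1 $ i else A x $ i $ j)) differentiable (at p)"
    by (intro differentiable_det) simp
  moreover have "(\<lambda>x. det (A x)) differentiable (at p)"
    by (rule differentiable_det[OF A])
  moreover have "det (A p) \<noteq> 0"
    using inv[OF S(2)] by (simp add: invertible_det_nz)
  ultimately have "(\<lambda>x. det (\<chi> i j. if j = k then axis l 1 $ i else A x $ i $ j) / det (A x)) differentiable (at p)"
    by (rule differentiable_divide)
  then obtain D where
    "((\<lambda>x. det (\<chi> i j. if j = k then axis l 1 $ i else A x $ i $ j) / det (A x)) has_derivative D) (at p)"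
    by (auto simp: differentiable_def)
  then have "((\<lambda>x. matrix_inv (A x) $ k $ l) has_derivative D) (at p)"
    by (rule has_derivative_transform_within_open[OF _ S]) (simp add: matrix_inv_cramer[OF inv])
  then show ?thesis
    by (rule differentiableI)
qed

lemma differentiable_matrix_entry:
  assumes "A differentiable (at p)"
  shows "(\<lambda>x. A x $ i $ j) differentiable (at p)"
    and "frechet_derivative (\<lambda>x. A x $ i $ j) (at p) v = frechet_derivative A (at p) v $ i $ j"
proof -
  have "(A has_derivative frechet_derivative A (at p)) (at p)"
    using assms by (simp add: frechet_derivative_works)
  then have D: "((\<lambda>x. A x $ i $ j) has_derivative (\<lambda>v. frechet_derivative A (at p) v $ i $ j)) (at p)"
    by (intro bounded_linear.has_derivative[OF bounded_linear_vec_nth])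
  show "(\<lambda>x. A x $ i $ j) differentiable (at p)"
    by (rule differentiableI[OF D])
  show "frechet_derivative (\<lambda>x. A x $ i $ j) (at p) v = frechet_derivative A (at p) v $ i $ j"
    by (rule fun_cong[OF sym[OF frechet_derivative_at[OF D]]])
qed

lemma differentiable_metric_partial:
  assumes M: "pseudo_riemannian_manifold M g" and p: "p \<in> M"
  shows "(\<lambda>x. metric_partial g x k i j) differentiable (at p)"
proof -
  have g: "open M" "smooth_on g M"
    using M by (auto simp: pseudo_riemannian_manifold_def)
  let ?P = "\<lambda>x. frechet_derivative g (at x) (axis k 1)"
  have "?P differentiable (at p)"
    by (rule differentiableI[OF smooth_on_directional_has_derivative[OF g(2,1) p]])
  then have "(\<lambda>x. ?P x $ i $ j) differentiable (at p)"
    by (rule differentiable_matrix_entry)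
  then obtain D where "((\<lambda>x. ?P x $ i $ j) has_derivative D) (at p)"
    by (auto simp: differentiable_def)
  then have "((\<lambda>x. metric_partial g x k i j) has_derivative D) (at p)"
    by (rule has_derivative_transform_within_open[OF _ g(1) p])
      (simp add: metric_partial_def differentiable_matrix_entry(2)[OF smooth_on_differentiable_at[OF g(2,1)]])
  then show ?thesis
    by (rule differentiableI)
qed

lemma differentiable_connection_form:
  assumes M: "pseudo_riemannian_manifold M g" and p: "p \<in> M"
  shows "(\<lambda>x. connection_form g x u v) differentiable (at p)"
proof -
  have g: "open M" "smooth_on g M" "\<And>x. x \<in> M \<Longrightarrow> invertible (g x)"
    using M by (auto simp: pseudo_riemannian_manifold_def)
  have "(\<lambda>x. matrix_inv (g x) $ k $ l) differentiable (at p)" for k l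
    by (rule differentiable_matrix_inv[OF g(1) p g(3)
          differentiable_matrix_entry(1)[OF smooth_on_differentiable_at[OF g(2,1) p]]])
  then have ch: "(\<lambda>x. christoffel g x i j k) differentiable (at p)" for i j k
    unfolding christoffel_def
    by (intro differentiable_divide differentiable_sum differentiable_mult differentiable_add
        differentiable_diff differentiable_const differentiable_metric_partial[OF M p] ballI) auto
  have "(\<lambda>x. \<Sum>i\<in>UNIV. \<Sum>j\<in>UNIV. christoffel g x i j k * u $ i * v $ j) differentiable (at p)" for k
    by (intro differentiable_sum differentiable_mult differentiable_const ch ballI) auto
  then have "((\<lambda>x. connection_form g x u v \<bullet> axis k 1) differentiable (at p))" for k
    by (simp add: connection_form_def inner_axis)
  then have *: "((\<lambda>x. connection_form g x u v \<bullet> b) differentiable (at p))" if "b \<in> Basis" for b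
    using that by (auto simp: Basis_vec_def)
  show ?thesis
    using * by (subst differentiable_componentwise_within) blast
qed

section \<open>Parallel bilinear forms\<close>

text \<open>
  \<open>\<nabla>T = 0\<close> at \<open>p\<close>, for the connection of \<open>g\<close> and a bilinear form \<open>T\<close> given by its matrix of components.
  The metric itself is the first example; a second one is the metric of one factor of a product.
\<close>

definition parallel_form :: "(real^'n \<Rightarrow> real^'n^'n) \<Rightarrow> (real^'n \<Rightarrow> real^'n^'n) \<Rightarrow> real^'n \<Rightarrow> bool" where
  "parallel_form g T p \<longleftrightarrow> (\<forall>u v w. frechet_derivative (\<lambda>x. metric_form T x v w) (at p) u =
     metric_form T p (connection_form g p u v) w + metric_form T p v (connection_form g p u w))"

lemma has_derivative_metric_form:
  fixes T :: "real^'n \<Rightarrow> real^'n^'n"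
  assumes T: "\<And>i j. (\<lambda>x. T x $ i $ j) differentiable (at p)"
  shows "((\<lambda>x. metric_form T x v w) has_derivative
    (\<lambda>u. metric_form (\<lambda>_. \<chi> i j. frechet_derivative (\<lambda>x. T x $ i $ j) (at p) u) p v w)) (at p)"
proof -
  have D: "((\<lambda>x. T x $ i $ j) has_derivative frechet_derivative (\<lambda>x. T x $ i $ j) (at p)) (at p)" for i j
    using T by (simp add: frechet_derivative_works)
  show ?thesis
    unfolding metric_form_def vec_lambda_beta
    by (intro has_derivative_sum has_derivative_mult_left D)
qed

lemma differentiable_metric_form:
  fixes T :: "real^'n \<Rightarrow> real^'n^'n"
  assumes T: "\<And>i j. (\<lambda>x. T x $ i $ j) differentiable (at p)"
  shows "(\<lambda>x. metric_form T x v w) differentiable (at p)"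
  by (rule differentiableI[OF has_derivative_metric_form[OF T]])

lemma bilinear_linear:
  assumes "bilinear B" "linear f"
  shows "linear (\<lambda>x. B (f x) c)" "linear (\<lambda>x. B c (f x))"
  using linear_compose[OF assms(2), of "\<lambda>x. B x c"] linear_compose[OF assms(2), of "B c"] assms(1)
  by (auto simp: bilinear_def o_def)

lemma bilinear_linear_arg:
  assumes "bilinear B"
  shows "linear (\<lambda>x. B x c)" "linear (B c)"
  using assms by (auto simp: bilinear_def)

lemma parallel_formI:
  fixes g T :: "real^'n \<Rightarrow> real^'n^'n"
  assumes T: "\<And>i j. (\<lambda>x. T x $ i $ j) differentiable (at p)"
    and eq: "\<And>k i j. metric_partial T p k i j =
      (\<Sum>l\<in>UNIV. christoffel g p k i l * T p $ l $ j) + (\<Sum>l\<in>UNIV. christoffel g p k j l * T p $ i $ l)"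
  shows "parallel_form g T p"
proof -
  let ?T = "\<lambda>u::real^'n. \<lambda>_::real^'n. \<chi> i j. frechet_derivative (\<lambda>x. T x $ i $ j) (at p) u"
  have D: "frechet_derivative (\<lambda>x. metric_form T x v w) (at p) u = metric_form (?T u) p v w" for u v w
    by (rule fun_cong[OF sym[OF frechet_derivative_at[OF has_derivative_metric_form[OF T]]]])
  have "metric_form (?T u) p v w =
      metric_form T p (connection_form g p u v) w + metric_form T p v (connection_form g p u w)" for u v w
  proof (rule trilinear_eq_on_axis[where f = "\<lambda>u v w. metric_form (?T u) p v w"])
    show "linear (\<lambda>u. metric_form (?T u) p v w)" for v w
      using linear_frechet_derivative[OF differentiable_metric_form[OF T, of v w]] by (simp add: D[abs_def])
    show "linear (\<lambda>v. metric_form (?T u) p v w)" "linear (\<lambda>w. metric_form (?T u) p v w)" for u v w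
      by (rule bilinear_linear_arg[OF bilinear_metric_form])+
    show "linear (\<lambda>u. metric_form T p (connection_form g p u v) w + metric_form T p v (connection_form g p u w))"
      "linear (\<lambda>v. metric_form T p (connection_form g p u v) w + metric_form T p v (connection_form g p u w))"
      "linear (\<lambda>w. metric_form T p (connection_form g p u v) w + metric_form T p v (connection_form g p u w))"
      for u v w
      by (intro linear_compose_add bilinear_linear[OF bilinear_metric_form] linear_ident
          bilinear_linear_arg[OF bilinear_connection_form] bilinear_linear_arg[OF bilinear_metric_form])+
    show "metric_form (?T (axis k 1)) p (axis i 1) (axis j 1) =
        metric_form T p (connection_form g p (axis k 1) (axis i 1)) (axis j 1) +
        metric_form T p (axis i 1) (connection_form g p (axis k 1) (axis j 1))" for k i j
      using eq[of k i j] unfolding metric_form_axis(3) unfolding metric_form_axis(1,2) connection_form_axis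
      by (simp add: metric_partial_def mult.commute)
  qed
  then show ?thesis
    unfolding parallel_form_def D by blast
qed

lemma pseudo_riemannian_differentiable:
  assumes "pseudo_riemannian_manifold M g" "p \<in> M"
  shows "(\<lambda>x. g x $ i $ j) differentiable (at p)"
  using assms differentiable_matrix_entry(1)[OF smooth_on_differentiable_at]
  unfolding pseudo_riemannian_manifold_def by blast

lemma metric_parallel:
  assumes M: "pseudo_riemannian_manifold M g" and p: "p \<in> M"
  shows "parallel_form g g p"
  using levi_civita_unique[OF M p, THEN iffD2, OF refl]
  by (intro parallel_formI pseudo_riemannian_differentiable[OF M p]) blast

lemma connection_form_sym:
  assumes M: "pseudo_riemannian_manifold M g" and p: "p \<in> M"
  shows "connection_form g p u v = connection_form g p v u"
proof -
  have sym: "christoffel g p i j k = christoffel g p j i k" for i j k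
    using levi_civita_unique[OF M p, THEN iffD2, OF refl] by blast
  have "(\<Sum>i\<in>UNIV. \<Sum>j\<in>UNIV. christoffel g p i j k * u $ i * v $ j) =
      (\<Sum>i\<in>UNIV. \<Sum>j\<in>UNIV. christoffel g p i j k * v $ i * u $ j)" for k
    by (subst sum.swap, intro sum.cong refl, subst sym, simp)
  then show ?thesis
    by (simp add: connection_form_def)
qed

section \<open>Isometries preserve connection and curvature\<close>

text \<open>
  The product rule for a linear map that depends on the point and is linear on an open set only, as is
  the derivative of a map that is differentiable there.
\<close>

lemma has_derivative_linear_field:
  fixes L :: "'m::real_normed_vector \<Rightarrow> 'a::euclidean_space \<Rightarrow> 'c::real_normed_vector"
  assumes S: "open S" "p \<in> S" and lin: "\<And>x. x \<in> S \<Longrightarrow> linear (L x)"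
    and L: "\<And>a. (\<lambda>x. L x a) differentiable (at p)"
    and A: "(A has_derivative A') (at p)"
  shows "((\<lambda>x. L x (A x)) has_derivative
      (\<lambda>v. frechet_derivative (\<lambda>x. L x (A p)) (at p) v + L p (A' v))) (at p)"
proof -
  let ?D = "\<lambda>a. frechet_derivative (\<lambda>x. L x a) (at p)"
  have D: "((\<lambda>x. L x a) has_derivative ?D a) (at p)" for a
    using L by (simp add: frechet_derivative_works)
  have Da: "?D a v = (\<Sum>b\<in>Basis. (a \<bullet> b) *\<^sub>R ?D b v)" for a v
  proof -
    have "((\<lambda>x. \<Sum>b\<in>Basis. (a \<bullet> b) *\<^sub>R L x b) has_derivative
        (\<lambda>v. \<Sum>b\<in>Basis. (a \<bullet> b) *\<^sub>R ?D b v)) (at p)"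
      by (intro has_derivative_sum has_derivative_scaleR_right D)
    then have "((\<lambda>x. L x a) has_derivative (\<lambda>v. \<Sum>b\<in>Basis. (a \<bullet> b) *\<^sub>R ?D b v)) (at p)"
      by (rule has_derivative_transform_within_open[OF _ S]) (rule linear_eq_sum_Basis[OF lin, symmetric])
    from frechet_derivative_at[OF this] show ?thesis
      by (rule fun_cong[OF sym])
  qed
  have "((\<lambda>x. \<Sum>b\<in>Basis. (A x \<bullet> b) *\<^sub>R L x b) has_derivative
      (\<lambda>v. \<Sum>b\<in>Basis. (A p \<bullet> b) *\<^sub>R ?D b v + (A' v \<bullet> b) *\<^sub>R L p b)) (at p)"
    by (intro has_derivative_sum has_derivative_scaleR has_derivative_inner_left A D)
  then have "((\<lambda>x. L x (A x)) has_derivative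
      (\<lambda>v. \<Sum>b\<in>Basis. (A p \<bullet> b) *\<^sub>R ?D b v + (A' v \<bullet> b) *\<^sub>R L p b)) (at p)"
    by (rule has_derivative_transform_within_open[OF _ S]) (rule linear_eq_sum_Basis[OF lin, symmetric])
  moreover have "(\<Sum>b\<in>Basis. (A p \<bullet> b) *\<^sub>R ?D b v + (A' v \<bullet> b) *\<^sub>R L p b) = ?D (A p) v + L p (A' v)" for v
    unfolding Da[of "A p"] linear_eq_sum_Basis[OF lin[OF S(2)], of "A' v"] by (simp add: sum.distrib)
  ultimately show ?thesis
    by simp
qed

locale metric_isometry =
  fixes M :: "(real^'m) set" and g and N :: "(real^'n) set" and h and \<phi>
  assumes Mg: "pseudo_riemannian_manifold M g" and Nh: "pseudo_riemannian_manifold N h"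
    and iso: "isometry M g N h \<phi>"
begin

abbreviation F :: "real^'m \<Rightarrow> real^'m \<Rightarrow> real^'n" where
  "F x \<equiv> frechet_derivative \<phi> (at x)"

lemma opens: "open M" "open N"
  using Mg Nh by (auto simp: pseudo_riemannian_manifold_def)

lemma smooth: "smooth_on \<phi> M"
  using iso by (auto simp: isometry_def diffeomorphism_def)

lemma maps_into: "x \<in> M \<Longrightarrow> \<phi> x \<in> N"
  using iso by (auto simp: isometry_def diffeomorphism_def bij_betw_def)

lemma onto: "y \<in> N \<Longrightarrow> \<exists>x\<in>M. \<phi> x = y"
  using iso by (auto simp: isometry_def diffeomorphism_def bij_betw_def)

lemma F_isometric: "x \<in> M \<Longrightarrow> metric_form h (\<phi> x) (F x v) (F x w) = metric_form g x v w"
  using iso by (auto simp: isometry_def)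

lemma deriv: "x \<in> M \<Longrightarrow> (\<phi> has_derivative F x) (at x)"
  by (rule smooth_on_has_derivative[OF smooth opens(1)])

lemma linear_F: "x \<in> M \<Longrightarrow> linear (F x)"
  using deriv has_derivative_linear by blast

text \<open>
  The derivative of an isometry is invertible because the inverse map is differentiable as well.
\<close>

lemma F_inverse:
  assumes "x \<in> M"
  obtains G where "linear G" "\<And>v. G (F x v) = v" "\<And>w. F x (G w) = w"
proof -
  let ?\<psi> = "inv_into M \<phi>"
  have bij: "bij_betw \<phi> M N" and sm: "smooth_on ?\<psi> N"
    using iso by (auto simp: isometry_def diffeomorphism_def)
  have left: "?\<psi> (\<phi> z) = z" if "z \<in> M" for z
    using bij that by (simp add: bij_betw_def)
  have right: "\<phi> (?\<psi> y) = y" if "y \<in> N" for y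
    using bij that by (simp add: bij_betw_inv_into_right)
  have D\<psi>: "(?\<psi> has_derivative frechet_derivative ?\<psi> (at (\<phi> x))) (at (\<phi> x))"
    by (rule smooth_on_has_derivative[OF sm opens(2) maps_into[OF assms]])
  let ?G = "frechet_derivative ?\<psi> (at (\<phi> x))"
  have "((\<lambda>z. ?\<psi> (\<phi> z)) has_derivative (\<lambda>v. ?G (F x v))) (at x)"
    by (rule has_derivative_compose[OF deriv[OF assms] D\<psi>])
  then have "((\<lambda>z. z) has_derivative (\<lambda>v. ?G (F x v))) (at x)"
    by (rule has_derivative_transform_within_open[OF _ opens(1) assms]) (rule left)
  then have 1: "(\<lambda>v. ?G (F x v)) = (\<lambda>v. v)"
    by (rule has_derivative_unique[OF _ has_derivative_ident])
  have "(\<phi> has_derivative F x) (at (?\<psi> (\<phi> x)))"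
    using deriv[OF assms] by (simp add: left[OF assms])
  then have "((\<lambda>y. \<phi> (?\<psi> y)) has_derivative (\<lambda>w. F x (?G w))) (at (\<phi> x))"
    by (rule has_derivative_compose[OF D\<psi>])
  then have "((\<lambda>y. y) has_derivative (\<lambda>w. F x (?G w))) (at (\<phi> x))"
    by (rule has_derivative_transform_within_open[OF _ opens(2) maps_into[OF assms]]) (rule right)
  then have 2: "(\<lambda>w. F x (?G w)) = (\<lambda>w. w)"
    by (rule has_derivative_unique[OF _ has_derivative_ident])
  show thesis
    by (rule that[of ?G]) (use has_derivative_linear[OF D\<psi>] fun_cong[OF 1] fun_cong[OF 2] in auto)
qed

definition D2 :: "real^'m \<Rightarrow> real^'m \<Rightarrow> real^'m \<Rightarrow> real^'n" where
  "D2 x u v = frechet_derivative (\<lambda>y. F y v) (at x) u"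

lemma D2: "x \<in> M \<Longrightarrow> ((\<lambda>y. F y v) has_derivative (\<lambda>u. D2 x u v)) (at x)"
  unfolding D2_def by (rule smooth_on_directional_has_derivative[OF smooth opens(1)])

lemma D2_sym: "x \<in> M \<Longrightarrow> D2 x u v = D2 x v u"
  unfolding D2_def by (rule smooth_on_second_derivative_symmetric[OF smooth opens(1)])

text \<open>
  The covariant derivative of \<open>F v\<close>, a field of vectors along \<open>\<phi>\<close>, with respect to the connection of the
  target.
\<close>

definition cov_D2 :: "real^'m \<Rightarrow> real^'m \<Rightarrow> real^'m \<Rightarrow> real^'n" where
  "cov_D2 x u v = D2 x u v + connection_form h (\<phi> x) (F x u) (F x v)"

lemma cov_D2_sym: "x \<in> M \<Longrightarrow> cov_D2 x u v = cov_D2 x v u"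
  unfolding cov_D2_def by (simp add: D2_sym[of x u] connection_form_sym[OF Nh maps_into, of x "F x u"])

lemma bilinear_cov_D2:
  assumes "x \<in> M"
  shows "bilinear (cov_D2 x)"
proof -
  have 1: "linear (\<lambda>u. cov_D2 x u v)" for v
    unfolding cov_D2_def using has_derivative_linear[OF D2[OF assms]]
    by (intro linear_compose_add bilinear_linear(1)[OF bilinear_connection_form] linear_F assms) auto
  have 2: "cov_D2 x u = (\<lambda>v. cov_D2 x v u)" for u
    by (rule ext) (rule cov_D2_sym[OF assms])
  have "linear (cov_D2 x u)" for u
    by (subst 2) (rule 1)
  with 1 show ?thesis
    unfolding bilinear_def by blast
qed

text \<open>
  The derivative of the pullback of a parallel form involves the second derivative of \<open>\<phi>\<close> only through
  \<open>cov_D2\<close>, since the derivative of \<open>T\<close> itself is absorbed by the connection of the target.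
\<close>

lemma pullback_form_has_derivative:
  fixes T :: "real^'n \<Rightarrow> real^'n^'n"
  assumes x: "x \<in> M" and T: "\<And>i j. (\<lambda>y. T y $ i $ j) differentiable (at (\<phi> x))"
    and par: "parallel_form h T (\<phi> x)"
  shows "((\<lambda>y. metric_form T (\<phi> y) (F y v) (F y w)) has_derivative
    (\<lambda>u. metric_form T (\<phi> x) (cov_D2 x u v) (F x w) + metric_form T (\<phi> x) (F x v) (cov_D2 x u w))) (at x)"
proof -
  have B: "bilinear (metric_form T (\<phi> x))"
    by (rule bilinear_metric_form)
  have "((\<lambda>y. metric_form T (\<phi> y) (F y v) (F y w)) has_derivative
    (\<lambda>u. frechet_derivative (\<lambda>y. metric_form T y (F x v) (F x w)) (at (\<phi> x)) (F x u)
       + metric_form T (\<phi> x) (D2 x u v) (F x w) + metric_form T (\<phi> x) (F x v) (D2 x u w))) (at x)"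
    by (rule has_derivative_bilinear_field[OF bilinear_metric_form differentiable_metric_form[OF T]
          deriv[OF x] D2[OF x] D2[OF x]])
  moreover have "frechet_derivative (\<lambda>y. metric_form T y (F x v) (F x w)) (at (\<phi> x)) (F x u)
       + metric_form T (\<phi> x) (D2 x u v) (F x w) + metric_form T (\<phi> x) (F x v) (D2 x u w)
      = metric_form T (\<phi> x) (cov_D2 x u v) (F x w) + metric_form T (\<phi> x) (F x v) (cov_D2 x u w)" for u
    using par unfolding parallel_form_def cov_D2_def
    by (simp add: bilinear_ladd[OF B] bilinear_radd[OF B])
  ultimately show ?thesis
    by simp
qed

text \<open>
  Transported back by \<open>F\<close>, the symmetric bilinear map \<open>cov_D2\<close> is a torsion-free connection, and
  \<open>pullback_form_has_derivative\<close> for \<open>T = h\<close> says that it is compatible with \<open>g\<close>. The uniqueness of the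
  Levi-Civita connection does the rest.
\<close>

theorem connection_natural:
  assumes x: "x \<in> M"
  shows "cov_D2 x u v = F x (connection_form g x u v)"
proof -
  obtain G where G: "linear G" "\<And>v. G (F x v) = v" "\<And>w. F x (G w) = w"
    using F_inverse[OF x] by blast
  define \<Gamma> where "\<Gamma> i j k = G (cov_D2 x (axis i 1) (axis j 1)) $ k" for i j k
  have "metric_partial g x k i j =
      (\<Sum>l\<in>UNIV. \<Gamma> k i l * g x $ l $ j) + (\<Sum>l\<in>UNIV. \<Gamma> k j l * g x $ i $ l)" for k i j
  proof -
    let ?e = "\<lambda>i. axis i 1 :: real^'m"
    have "((\<lambda>y. metric_form h (\<phi> y) (F y (?e i)) (F y (?e j))) has_derivative
      (\<lambda>u. metric_form h (\<phi> x) (cov_D2 x u (?e i)) (F x (?e j))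
         + metric_form h (\<phi> x) (F x (?e i)) (cov_D2 x u (?e j)))) (at x)"
      by (rule pullback_form_has_derivative[OF x pseudo_riemannian_differentiable[OF Nh maps_into[OF x]]
            metric_parallel[OF Nh maps_into[OF x]]])
    then have "((\<lambda>y. g y $ i $ j) has_derivative
      (\<lambda>u. metric_form h (\<phi> x) (cov_D2 x u (?e i)) (F x (?e j))
         + metric_form h (\<phi> x) (F x (?e i)) (cov_D2 x u (?e j)))) (at x)"
      by (rule has_derivative_transform_within_open[OF _ opens(1) x])
        (simp add: F_isometric metric_form_axis(3))
    from frechet_derivative_at[OF this]
    have "metric_partial g x k i j = metric_form h (\<phi> x) (F x (G (cov_D2 x (?e k) (?e i)))) (F x (?e j))
         + metric_form h (\<phi> x) (F x (?e i)) (F x (G (cov_D2 x (?e k) (?e j))))"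
      unfolding metric_partial_def G(3) by (rule fun_cong[OF sym])
    also have "\<dots> = metric_form g x (G (cov_D2 x (?e k) (?e i))) (?e j)
         + metric_form g x (?e i) (G (cov_D2 x (?e k) (?e j)))"
      by (simp only: F_isometric[OF x])
    finally show ?thesis
      unfolding metric_form_axis \<Gamma>_def by (simp add: mult.commute)
  qed
  moreover have "\<Gamma> i j k = \<Gamma> j i k" for i j k
    unfolding \<Gamma>_def by (simp add: cov_D2_sym[OF x, of "axis i 1"])
  ultimately have ch: "\<Gamma> = christoffel g x"
    using levi_civita_unique[OF Mg x, of \<Gamma>] by blast
  have "cov_D2 x (axis i 1) (axis j 1) = F x (connection_form g x (axis i 1) (axis j 1))" for i j
  proof -
    have "connection_form g x (axis i 1) (axis j 1) = G (cov_D2 x (axis i 1) (axis j 1))"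
      by (simp add: vec_eq_iff connection_form_axis ch[symmetric] \<Gamma>_def)
    then show ?thesis
      by (simp add: G(3))
  qed
  moreover have "bilinear (\<lambda>u v. F x (connection_form g x u v))"
    using bilinear_connection_form[of g x] linear_F[OF x] linear_compose[of _ "F x"]
    unfolding bilinear_def o_def by blast
  ultimately show ?thesis
    using bilinear_eq_stdbasis[OF bilinear_cov_D2[OF x], of "\<lambda>u v. F x (connection_form g x u v)"]
    by (simp add: Basis_vec_def) metis
qed

lemma D2_eq: "x \<in> M \<Longrightarrow>
    D2 x u v = F x (connection_form g x u v) - connection_form h (\<phi> x) (F x u) (F x v)"
  using connection_natural[of x u v] by (simp add: cov_D2_def eq_diff_eq)

text \<open>
  By \<open>connection_natural\<close> the isometry satisfies \<open>D\<^sup>2\<phi>(b, c) = F (\<Gamma>(b, c)) - \<Gamma>'(F b, F c)\<close>, a second order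
  equation that can be differentiated once more. Of the resulting terms, the first two become
  curvature operators when \<open>a\<close> and \<open>b\<close> are interchanged and the results subtracted; the other two are
  symmetric in \<open>a\<close> and \<open>b\<close>.
\<close>

lemma third_derivative:
  assumes x: "x \<in> M"
  shows "((\<lambda>y. D2 y b c) has_derivative (\<lambda>a.
      F x (frechet_derivative (\<lambda>q. connection_form g q b c) (at x) a
           + connection_form g x a (connection_form g x b c))
      - (frechet_derivative (\<lambda>q. connection_form h q (F x b) (F x c)) (at (\<phi> x)) (F x a)
           + connection_form h (\<phi> x) (F x a) (connection_form h (\<phi> x) (F x b) (F x c)))
      - (connection_form h (\<phi> x) (F x a) (D2 x b c) + connection_form h (\<phi> x) (F x b) (D2 x a c))
      - connection_form h (\<phi> x) (D2 x a b) (F x c))) (at x)"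
proof -
  let ?C = "connection_form g x" and ?H = "connection_form h (\<phi> x)"
  let ?DC = "frechet_derivative (\<lambda>q. connection_form g q b c) (at x)"
  let ?DH = "frechet_derivative (\<lambda>q. connection_form h q (F x b) (F x c)) (at (\<phi> x))"
  have DC: "((\<lambda>q. connection_form g q b c) has_derivative ?DC) (at x)"
    using differentiable_connection_form[OF Mg x] by (simp add: frechet_derivative_works)
  have F': "(\<lambda>y. F y a) differentiable (at x)" for a
    by (rule differentiableI[OF D2[OF x]])
  have 1: "((\<lambda>y. F y (connection_form g y b c)) has_derivative
      (\<lambda>a. D2 x a (?C b c) + F x (?DC a))) (at x)"
    using has_derivative_linear_field[OF opens(1) x linear_F F' DC] by (simp add: D2_def)
  have 2: "((\<lambda>y. connection_form h (\<phi> y) (F y b) (F y c)) has_derivative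
      (\<lambda>a. ?DH (F x a) + ?H (D2 x a b) (F x c) + ?H (F x b) (D2 x a c))) (at x)"
    by (rule has_derivative_bilinear_field[OF bilinear_connection_form
          differentiable_connection_form[OF Nh maps_into[OF x]] deriv[OF x] D2[OF x] D2[OF x]])
  have "((\<lambda>y. D2 y b c) has_derivative (\<lambda>a. (D2 x a (?C b c) + F x (?DC a)) -
      (?DH (F x a) + ?H (D2 x a b) (F x c) + ?H (F x b) (D2 x a c)))) (at x)"
    by (rule has_derivative_transform_within_open[OF has_derivative_diff[OF 1 2] opens(1) x])
      (simp add: D2_eq)
  moreover have "(D2 x a (?C b c) + F x (?DC a)) -
      (?DH (F x a) + ?H (D2 x a b) (F x c) + ?H (F x b) (D2 x a c)) =
      F x (?DC a + ?C a (?C b c)) - (?DH (F x a) + ?H (F x a) (?H (F x b) (F x c)))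
      - (?H (F x a) (D2 x b c) + ?H (F x b) (D2 x a c)) - ?H (D2 x a b) (F x c)" for a
  proof -
    have "F x (?C b c) = D2 x b c + ?H (F x b) (F x c)"
      by (simp add: D2_eq[OF x])
    then have "D2 x a (?C b c) = F x (?C a (?C b c)) - ?H (F x a) (D2 x b c + ?H (F x b) (F x c))"
      by (simp add: D2_eq[OF x, of a])
    then show ?thesis
      by (simp add: linear_add[OF linear_F[OF x]] bilinear_radd[OF bilinear_connection_form])
  qed
  ultimately show ?thesis
    by simp
qed

text \<open>
  The third derivative of \<open>\<phi>\<close> is symmetric in its first two arguments, so the non-symmetric part of
  \<open>third_derivative\<close> has to vanish.
\<close>

theorem curvature_natural:
  assumes x: "x \<in> M"
  shows "curvature_operator h (\<phi> x) (F x a) (F x b) (F x c) = F x (curvature_operator g x a b c)"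
proof -
  have "((\<lambda>y. D2 y b c) has_derivative A) (at x) \<Longrightarrow> ((\<lambda>y. D2 y a c) has_derivative B) (at x) \<Longrightarrow>
      A a = B b" for A B
    using symmetric_second_derivative[OF opens(1) x D2[of _ c], where u = b and v = a and A = A and B = B] by blast
  from this[OF third_derivative[OF x] third_derivative[OF x]]
  show ?thesis
    unfolding curvature_operator_eq linear_diff[OF linear_F[OF x]]
    by (simp add: D2_sym[OF x, of b a] algebra_simps)
qed

end

subsection \<open>Pulling back parallel forms\<close>

context metric_isometry
begin

lemma pullback_parallel:
  fixes T :: "real^'n \<Rightarrow> real^'n^'n"
  assumes x: "x \<in> M" and T: "\<And>i j. (\<lambda>y. T y $ i $ j) differentiable (at (\<phi> x))"
    and par: "parallel_form h T (\<phi> x)"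
  shows "((\<lambda>y. metric_form T (\<phi> y) (F y v) (F y w)) has_derivative
    (\<lambda>u. metric_form T (\<phi> x) (F x (connection_form g x u v)) (F x w)
       + metric_form T (\<phi> x) (F x v) (F x (connection_form g x u w)))) (at x)"
  using pullback_form_has_derivative[OF assms] by (simp add: connection_natural[OF x])

end

section \<open>Orthogonal product metrics\<close>

lemma linear_coord_proj: "linear (coord_proj I)"
  by (auto intro!: linearI simp: coord_proj_def vec_eq_iff)

lemma split_metric_off_block:
  "(i \<in> I) \<noteq> (j \<in> I) \<Longrightarrow> split_metric I g1 g2 q $ i $ j = 0"
  by (auto simp: split_metric_def)

text \<open>
  The components of one factor do not vary along the coordinate lines of the other one. Differentiability
  is assumed, so it is enough to look at the restriction to such a line.
\<close>

lemma metric_partial_split_metric: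
  fixes I :: "'n::finite set"
  assumes d: "\<And>i j. (\<lambda>x. split_metric I g1 g2 x $ i $ j) differentiable (at q)"
    and ne: "\<not> ((k \<in> I) = (i \<in> I) \<and> (i \<in> I) = (j \<in> I))"
  shows "metric_partial (split_metric I g1 g2) q k i j = 0"
proof -
  let ?f = "\<lambda>x. split_metric I g1 g2 x $ i $ j"
  have const: "?f (q + t *\<^sub>R axis k 1) = ?f q" for t
  proof (cases "(i \<in> I) = (j \<in> I)")
    case True
    then have "(k \<in> I) \<noteq> (i \<in> I)" using ne by blast
    then have "i \<in> I \<Longrightarrow> coord_proj I (q + t *\<^sub>R axis k 1) = coord_proj I q"
      "i \<notin> I \<Longrightarrow> coord_proj (- I) (q + t *\<^sub>R axis k 1) = coord_proj (- I) q"
      by (auto simp: coord_proj_def vec_eq_iff axis_def)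
    then show ?thesis
      using True by (simp add: split_metric_def)
  next
    case False
    then show ?thesis by (simp add: split_metric_off_block)
  qed
  have "(?f has_derivative frechet_derivative ?f (at q)) (at (q + 0 *\<^sub>R axis k 1))"
    using d by (simp add: frechet_derivative_works)
  moreover have "((\<lambda>t. q + t *\<^sub>R axis k 1) has_derivative (\<lambda>t. t *\<^sub>R axis k 1)) (at 0)"
    by (auto intro!: derivative_eq_intros)
  ultimately have "((\<lambda>t. ?f (q + t *\<^sub>R axis k 1)) has_derivative
      (\<lambda>t. frechet_derivative ?f (at q) (t *\<^sub>R axis k 1))) (at 0)"
    using has_derivative_compose by blast
  then have "((\<lambda>t. ?f q) has_derivative (\<lambda>t. frechet_derivative ?f (at q) (t *\<^sub>R axis k 1))) (at (0::real))"
    unfolding const .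
  then have "(\<lambda>t. frechet_derivative ?f (at q) (t *\<^sub>R axis k 1)) = (\<lambda>t::real. 0)"
    by (rule has_derivative_unique[OF _ has_derivative_const])
  from fun_cong[OF this, of 1] show ?thesis
    by (simp add: metric_partial_def)
qed

lemma matrix_inv_block:
  fixes A :: "real^'n^'n"
  assumes A: "invertible A" and block: "\<And>i j. (i \<in> I) \<noteq> (j \<in> I) \<Longrightarrow> A $ i $ j = 0"
    and kl: "(k \<in> I) \<noteq> (l \<in> I)"
  shows "matrix_inv A $ k $ l = 0"
proof -
  let ?P = "\<chi> i j. if i = j \<and> i \<in> I then 1 else (0::real)"
  have right: "(B ** ?P) $ i $ j = (if j \<in> I then B $ i $ j else 0)" for B :: "real^'n^'n" and i j
  proof -
    have "(B ** ?P) $ i $ j = (\<Sum>m\<in>UNIV. if m = j then (if j \<in> I then B $ i $ j else 0) else 0)"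
      unfolding matrix_matrix_mult_def vec_lambda_beta by (intro sum.cong) auto
    then show ?thesis by simp
  qed
  have left: "(?P ** B) $ i $ j = (if i \<in> I then B $ i $ j else 0)" for B :: "real^'n^'n" and i j
  proof -
    have "(?P ** B) $ i $ j = (\<Sum>m\<in>UNIV. if m = i then (if i \<in> I then B $ i $ j else 0) else 0)"
      unfolding matrix_matrix_mult_def vec_lambda_beta by (intro sum.cong) auto
    then show ?thesis by simp
  qed
  have comm: "A ** ?P = ?P ** A"
    using block by (simp add: vec_eq_iff left right)
  let ?K = "matrix_inv A"
  have "?P ** ?K = (?K ** A) ** ?P ** ?K"
    by (simp only: matrix_inv_mult(1)[OF A] matrix_mul_lid)
  also have "\<dots> = ?K ** (A ** ?P) ** ?K"
    by (simp only: matrix_mul_assoc)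
  also have "\<dots> = (?K ** ?P) ** (A ** ?K)"
    unfolding comm by (simp only: matrix_mul_assoc)
  also have "\<dots> = ?K ** ?P"
    by (simp only: matrix_inv_mult(2)[OF A] matrix_mul_rid)
  finally have "?P ** ?K = ?K ** ?P" .
  then have "(?P ** matrix_inv A) $ k $ l = (matrix_inv A ** ?P) $ k $ l"
    by simp
  then show ?thesis
    using kl unfolding left right by (auto split: if_splits)
qed

text \<open>
  For a product metric, the inverse matrix and the first partial derivatives respect the splitting of
  the indices, hence so do the Christoffel symbols. Everything else about products follows from that.
\<close>

locale product_metric =
  fixes I :: "'n::finite set" and N g1 g2 h
  defines "h \<equiv> split_metric I g1 g2"
  assumes Nh: "pseudo_riemannian_manifold N h"
begin

lemma christoffel_block:
  assumes q: "q \<in> N" and ne: "\<not> ((i \<in> I) = (j \<in> I) \<and> (j \<in> I) = (k \<in> I))"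
  shows "christoffel h q i j k = 0"
proof -
  have inv: "invertible (h q)"
    using Nh q by (simp add: pseudo_riemannian_manifold_def)
  have part: "metric_partial h q i j l = 0" if "\<not> ((i \<in> I) = (j \<in> I) \<and> (j \<in> I) = (l \<in> I))" for i j l
    using that pseudo_riemannian_differentiable[OF Nh q] unfolding h_def
    by (intro metric_partial_split_metric) auto
  have off: "matrix_inv (h q) $ k $ l = 0" if "(k \<in> I) \<noteq> (l \<in> I)" for k l
    using that by (intro matrix_inv_block[OF inv]) (auto simp: h_def split_metric_off_block)
  have "matrix_inv (h q) $ k $ l *
      (metric_partial h q i j l + metric_partial h q j i l - metric_partial h q l i j) = 0" for l
  proof (cases "(k \<in> I) = (l \<in> I)")
    case True
    then have "metric_partial h q i j l = 0" "metric_partial h q j i l = 0" "metric_partial h q l i j = 0"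
      using ne by (auto intro!: part)
    then show ?thesis by simp
  next
    case False
    then show ?thesis by (simp add: off)
  qed
  then show ?thesis
    unfolding christoffel_def by (simp only: sum.neutral_const div_0)
qed

text \<open>
  The metric of the first factor, extended by zero: the bilinear form that corresponds to the orthogonal
  projection onto that factor.
\<close>

definition factor_form :: "real^'n \<Rightarrow> real^'n^'n" where
  "factor_form q = (\<chi> i j. if i \<in> I \<and> j \<in> I then h q $ i $ j else 0)"

lemma factor_form_eq: "metric_form factor_form q v w = metric_form h q (coord_proj I v) w"
proof -
  have "factor_form q $ i $ j * v $ i * w $ j = h q $ i $ j * coord_proj I v $ i * w $ j" for i j
    by (auto simp: factor_form_def coord_proj_def h_def split_metric_off_block)
  then show ?thesis
    by (simp only: metric_form_def)
qed

lemma factor_form_eq': "metric_form factor_form q v w = metric_form h q v (coord_proj I w)"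
proof -
  have "factor_form q $ i $ j * v $ i * w $ j = h q $ i $ j * v $ i * coord_proj I w $ j" for i j
    by (auto simp: factor_form_def coord_proj_def h_def split_metric_off_block)
  then show ?thesis
    by (simp only: metric_form_def)
qed

lemma factor_form_differentiable:
  assumes "q \<in> N"
  shows "(\<lambda>x. factor_form x $ i $ j) differentiable (at q)"
  using pseudo_riemannian_differentiable[OF Nh assms]
  by (cases "i \<in> I \<and> j \<in> I") (auto simp: factor_form_def)

lemma factor_form_parallel:
  assumes q: "q \<in> N"
  shows "parallel_form h factor_form q"
proof (rule parallel_formI)
  show "(\<lambda>x. factor_form x $ i $ j) differentiable (at q)" for i j
    by (rule factor_form_differentiable[OF q])
  show "metric_partial factor_form q k i j = (\<Sum>l\<in>UNIV. christoffel h q k i l * factor_form q $ l $ j)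
      + (\<Sum>l\<in>UNIV. christoffel h q k j l * factor_form q $ i $ l)" for k i j
  proof (cases "i \<in> I \<and> j \<in> I")
    case True
    have "christoffel h q k i l * factor_form q $ l $ j = christoffel h q k i l * h q $ l $ j"
      "christoffel h q k j l * factor_form q $ i $ l = christoffel h q k j l * h q $ i $ l" for l
      using True by (auto simp: factor_form_def h_def split_metric_off_block)
    moreover have "metric_partial h q k i j =
        (\<Sum>l\<in>UNIV. christoffel h q k i l * h q $ l $ j) + (\<Sum>l\<in>UNIV. christoffel h q k j l * h q $ i $ l)"
      using levi_civita_unique[OF Nh q, THEN iffD2, OF refl] by blast
    moreover have "metric_partial factor_form q k i j = metric_partial h q k i j"
      using True by (simp add: metric_partial_def factor_form_def)
    ultimately show ?thesis by (simp only:)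
  next
    case False
    have "christoffel h q k i l * factor_form q $ l $ j = 0"
      "christoffel h q k j l * factor_form q $ i $ l = 0" for l
      using False christoffel_block[OF q] by (auto simp: factor_form_def)
    moreover have "metric_partial factor_form q k i j = 0"
    proof -
      have "(\<lambda>x. factor_form x $ i $ j) = (\<lambda>x. 0)"
        using False by (auto simp: factor_form_def)
      then show ?thesis by (simp add: metric_partial_def)
    qed
    ultimately show ?thesis by (simp only: sum.neutral_const add_0)
  qed
qed

lemma connection_form_coord_proj:
  assumes q: "q \<in> N"
  shows "connection_form h q u (coord_proj I v) = coord_proj I (connection_form h q u v)"
proof -
  have "christoffel h q i j k * u $ i * coord_proj I v $ j =
      (if k \<in> I then christoffel h q i j k * u $ i * v $ j else 0)" for i j k
    using christoffel_block[OF q, of i j k] by (auto simp: coord_proj_def)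
  then show ?thesis
    by (simp add: connection_form_def coord_proj_def vec_eq_iff)
qed

lemma curvature_coord_proj:
  assumes q: "q \<in> N"
  shows "curvature_operator h q x y (coord_proj I z) = coord_proj I (curvature_operator h q x y z)"
proof -
  have opn: "open N"
    using Nh by (simp add: pseudo_riemannian_manifold_def)
  have D: "frechet_derivative (\<lambda>p. connection_form h p y (coord_proj I z)) (at q) x =
      coord_proj I (frechet_derivative (\<lambda>p. connection_form h p y z) (at q) x)" for x y
  proof -
    have "((\<lambda>p. connection_form h p y z) has_derivative
        frechet_derivative (\<lambda>p. connection_form h p y z) (at q)) (at q)"
      using differentiable_connection_form[OF Nh q] by (simp add: frechet_derivative_works)
    then have "((\<lambda>p. coord_proj I (connection_form h p y z)) has_derivative
        (\<lambda>x. coord_proj I (frechet_derivative (\<lambda>p. connection_form h p y z) (at q) x))) (at q)"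
      by (rule bounded_linear.has_derivative[OF linear_conv_bounded_linear[THEN iffD1, OF linear_coord_proj]])
    then have "((\<lambda>p. connection_form h p y (coord_proj I z)) has_derivative
        (\<lambda>x. coord_proj I (frechet_derivative (\<lambda>p. connection_form h p y z) (at q) x))) (at q)"
      by (rule has_derivative_transform_within_open[OF _ opn q]) (simp add: connection_form_coord_proj)
    then show ?thesis
      by (rule fun_cong[OF sym[OF frechet_derivative_at]])
  qed
  show ?thesis
    unfolding curvature_operator_eq D connection_form_coord_proj[OF q]
    by (simp only: linear_add[OF linear_coord_proj] linear_diff[OF linear_coord_proj])
qed

end

text \<open>
  The field \<open>E\<close> is the projection onto the first factor, transported to \<open>U\<close> by the isometry. That it is
  parallel is expressed through the bilinear form \<open>g (E v) w\<close>, whose differentiability, unlike that of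
  \<open>E\<close>, is immediate. It is nowhere scalar because both factors have positive dimension.
\<close>

theorem reducible_imp_parallel_endomorphism:
  fixes g :: "real^'n \<Rightarrow> real^'n^'n"
  assumes M: "pseudo_riemannian_manifold M g" and red: "reducible_at M g P"
  obtains U E where "open U" "P \<in> U" "U \<subseteq> M"
    and "\<And>x v w. x \<in> U \<Longrightarrow> metric_form g x (E x v) w = metric_form g x v (E x w)"
    and "\<And>x v w. x \<in> U \<Longrightarrow> ((\<lambda>y. metric_form g y (E y v) w) has_derivative
          (\<lambda>u. metric_form g x (E x (connection_form g x u v)) w
             + metric_form g x (E x v) (connection_form g x u w))) (at x)"
    and "\<And>x a b c. x \<in> U \<Longrightarrow> E x (curvature_operator g x a b c) = curvature_operator g x a b (E x c)"
    and "\<And>x c. x \<in> U \<Longrightarrow> \<exists>v. E x v \<noteq> c *\<^sub>R v"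
proof -
  obtain U I A B g1 g2 where U: "open U" "P \<in> U" "U \<subseteq> M" and I: "I \<noteq> {}" "I \<noteq> (UNIV::'n set)"
    and N: "pseudo_riemannian_manifold (split_domain I A B) (split_metric I g1 g2)"
    and ex: "isometric U g (split_domain I A B) (split_metric I g1 g2)"
    using red unfolding reducible_at_def by blast
  define N where "N = split_domain I A B"
  define h where "h = split_metric I g1 g2"
  obtain \<phi> where \<phi>: "isometry U g N h \<phi>"
    using ex unfolding isometric_def N_def h_def by blast
  have Ug: "pseudo_riemannian_manifold U g"
    using M U smooth_on_subset unfolding pseudo_riemannian_manifold_def by blast
  interpret metric_isometry U g N h \<phi>
    by (unfold_locales) (use Ug N \<phi> in \<open>simp_all add: N_def h_def\<close>)
  interpret product_metric I N g1 g2 h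
    by (unfold_locales) (use N in \<open>simp_all add: N_def h_def\<close>)
  have "\<exists>G. linear G \<and> (\<forall>v. G (F x v) = v) \<and> (\<forall>w. F x (G w) = w)" if "x \<in> U" for x
    using F_inverse[OF that] by metis
  then obtain G where "\<forall>x\<in>U. linear (G x) \<and> (\<forall>v. G x (F x v) = v) \<and> (\<forall>w. F x (G x w) = w)"
    using bchoice[of U "\<lambda>x G. linear G \<and> (\<forall>v. G (F x v) = v) \<and> (\<forall>w. F x (G w) = w)"] by blast
  then have G: "G x (F x v) = v" "F x (G x w) = w" if "x \<in> U" for x v w
    using that by auto
  define E where "E x v = G x (coord_proj I (F x v))" for x v
  have FE: "F x (E x v) = coord_proj I (F x v)" if "x \<in> U" for x v
    using G[OF that] by (simp add: E_def)
  have Q: "metric_form g x (E x v) w = metric_form factor_form (\<phi> x) (F x v) (F x w)" if "x \<in> U" for x v w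
    by (simp add: F_isometric[OF that, symmetric] FE[OF that] factor_form_eq)
  have Q': "metric_form g x v (E x w) = metric_form factor_form (\<phi> x) (F x v) (F x w)" if "x \<in> U" for x v w
    by (simp add: F_isometric[OF that, symmetric] FE[OF that] factor_form_eq')
  show thesis
  proof (rule that[OF U, of E])
    show "metric_form g x (E x v) w = metric_form g x v (E x w)" if "x \<in> U" for x v w
      by (simp add: Q[OF that] Q'[OF that])
    show "((\<lambda>y. metric_form g y (E y v) w) has_derivative
          (\<lambda>u. metric_form g x (E x (connection_form g x u v)) w
             + metric_form g x (E x v) (connection_form g x u w))) (at x)" if x: "x \<in> U" for x v w
      unfolding Q[OF x]
      by (rule has_derivative_transform_within_open[OF pullback_parallel[OF x
              factor_form_differentiable[OF maps_into[OF x]] factor_form_parallel[OF maps_into[OF x]]] U(1) x])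
        (simp add: Q)
    show "E x (curvature_operator g x a b c) = curvature_operator g x a b (E x c)" if x: "x \<in> U" for x a b c
    proof -
      have "F x (E x (curvature_operator g x a b c)) = F x (curvature_operator g x a b (E x c))"
        by (simp add: FE[OF x] curvature_natural[OF x, symmetric] curvature_coord_proj[OF maps_into[OF x]])
      then show ?thesis
        using G(1)[OF x] by metis
    qed
    show "\<exists>v. E x v \<noteq> c *\<^sub>R v" if x: "x \<in> U" for x c
    proof (rule ccontr)
      assume "\<not> (\<exists>v. E x v \<noteq> c *\<^sub>R v)"
      then have "coord_proj I (F x v) = c *\<^sub>R F x v" for v
        using FE[OF x, of v] by (simp add: linear_scale[OF linear_F[OF x]])
      then have *: "coord_proj I w = c *\<^sub>R w" for w
        using G(2)[OF x] by metis
      obtain i j where "i \<in> I" "j \<notin> I"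
        using I by blast
      then show False
        using *[of "axis i 1"] *[of "axis j 1"]
        by (auto simp: coord_proj_def vec_eq_iff axis_def split: if_splits)
    qed
  qed
qed

section \<open>The metrics on the quadrant\<close>

lemma open_quadrant: "open quadrant"
proof -
  have "open ({x::real^4. 0 < x $ 3} \<inter> {x. 0 < x $ 4})"
    by (intro open_Int open_Collect_less continuous_intros)
  moreover have "quadrant = {x. 0 < x $ 3} \<inter> {x. 0 < x $ 4}"
    by (auto simp: quadrant_def)
  ultimately show ?thesis
    by simp
qed

lemma quadrant_pos:
  assumes "x \<in> quadrant" "\<beta> > 0"
  shows "x $ 3 > 0" "x $ 4 > 0" "x $ 3 + \<beta> * x $ 4 > 0"
  using assms by (auto simp: quadrant_def intro: add_pos_pos)

lemma g_beta_form:
  "metric_form (g_beta \<beta>) x v w = (x $ 3)\<^sup>2 * v $ 1 * w $ 1 + (x $ 3 + \<beta> * x $ 4)\<^sup>2 * v $ 2 * w $ 2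
     + v $ 3 * w $ 3 + v $ 4 * w $ 4"
  by (simp add: metric_form_def g_beta_def sum_4)

lemma g_beta_smooth: "smooth_on (g_beta \<beta>) S"
proof -
  define B :: "real^4 \<Rightarrow> real^4 \<Rightarrow> real^4^4" where
    "B x y = (\<chi> i j. if i \<noteq> j then 0 else if i = 1 then x $ 3 * y $ 3
       else if i = 2 then (x $ 3 + \<beta> * x $ 4) * (y $ 3 + \<beta> * y $ 4) else 0)" for x y
  define c :: "real^4^4" where "c = (\<chi> i j. if i = j \<and> i \<noteq> 1 \<and> i \<noteq> 2 then 1 else 0)"
  have "bilinear B"
    unfolding bilinear_def by (auto intro!: linearI simp: B_def vec_eq_iff algebra_simps)
  moreover have "g_beta \<beta> = (\<lambda>x. c + B x x)"
    by (auto simp: g_beta_def B_def c_def vec_eq_iff power2_eq_square)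
  ultimately show ?thesis
    using smooth_on_quadratic[of B c S] by simp
qed

definition g_beta_inv :: "real \<Rightarrow> real^4 \<Rightarrow> real^4^4" where
  "g_beta_inv \<beta> x = (\<chi> i j. if i \<noteq> j then 0 else inverse (g_beta \<beta> x $ i $ i))"

lemma g_beta_mult_inv:
  assumes "x \<in> quadrant" "\<beta> > 0"
  shows "g_beta \<beta> x ** g_beta_inv \<beta> x = mat 1" "g_beta_inv \<beta> x ** g_beta \<beta> x = mat 1"
  using quadrant_pos[OF assms]
  by (simp_all add: vec_eq_iff forall_4 matrix_matrix_mult_def sum_4 g_beta_inv_def g_beta_def mat_def)

lemma g_beta_invertible: "x \<in> quadrant \<Longrightarrow> \<beta> > 0 \<Longrightarrow> invertible (g_beta \<beta> x)"
  using g_beta_mult_inv unfolding invertible_def by blast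

lemma matrix_inv_g_beta:
  assumes "x \<in> quadrant" "\<beta> > 0"
  shows "matrix_inv (g_beta \<beta> x) = g_beta_inv \<beta> x"
proof -
  have "matrix_inv (g_beta \<beta> x) = matrix_inv (g_beta \<beta> x) ** (g_beta \<beta> x ** g_beta_inv \<beta> x)"
    by (simp add: g_beta_mult_inv[OF assms])
  also have "\<dots> = g_beta_inv \<beta> x"
    by (simp only: matrix_mul_assoc matrix_inv_mult(1)[OF g_beta_invertible[OF assms]] matrix_mul_lid)
  finally show ?thesis .
qed

theorem g_beta_riemannian:
  assumes "\<beta> > 0"
  shows "riemannian_manifold quadrant (g_beta \<beta>)"
proof -
  have "metric_form (g_beta \<beta>) x v v > 0" if x: "x \<in> quadrant" and v: "v \<noteq> 0" for x v
  proof -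
    have eq: "metric_form (g_beta \<beta>) x v v =
        (x $ 3 * v $ 1)\<^sup>2 + ((x $ 3 + \<beta> * x $ 4) * v $ 2)\<^sup>2 + (v $ 3)\<^sup>2 + (v $ 4)\<^sup>2"
      by (simp add: g_beta_form power2_eq_square algebra_simps)
    have "v $ 1 \<noteq> 0 \<or> v $ 2 \<noteq> 0 \<or> v $ 3 \<noteq> 0 \<or> v $ 4 \<noteq> 0"
      using v by (simp add: vec_eq_iff forall_4)
    then have "x $ 3 * v $ 1 \<noteq> 0 \<or> (x $ 3 + \<beta> * x $ 4) * v $ 2 \<noteq> 0 \<or> v $ 3 \<noteq> 0 \<or> v $ 4 \<noteq> 0"
      using quadrant_pos[OF x assms] by auto
    then have "metric_form (g_beta \<beta>) x v v \<noteq> 0"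
      unfolding eq by (auto simp: add_nonneg_eq_0_iff)
    then show ?thesis
      unfolding eq by (simp add: less_le)
  qed
  moreover have "transpose (g_beta \<beta> x) = g_beta \<beta> x" for x
    by (auto simp: transpose_def g_beta_def vec_eq_iff)
  ultimately show ?thesis
    using assms open_quadrant g_beta_smooth g_beta_invertible
    by (simp add: riemannian_manifold_def pseudo_riemannian_manifold_def)
qed

lemma g_beta_pseudo: "\<beta> > 0 \<Longrightarrow> pseudo_riemannian_manifold quadrant (g_beta \<beta>)"
  using g_beta_riemannian by (auto simp: riemannian_manifold_def)

lemma g_beta_partial:
  "metric_partial (g_beta \<beta>) x k i j =
    (if i \<noteq> j then 0
     else if i = 1 then (if k = 3 then 2 * x $ 3 else 0)
     else if i = 2 then (if k = 3 then 2 * (x $ 3 + \<beta> * x $ 4)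
                         else if k = 4 then 2 * \<beta> * (x $ 3 + \<beta> * x $ 4) else 0)
     else 0)"
proof -
  have n: "((\<lambda>x::real^4. x $ m) has_derivative (\<lambda>v. v $ m)) (at x)" for m
    by (rule bounded_linear_imp_has_derivative[OF bounded_linear_vec_nth])
  have 1: "((\<lambda>x::real^4. (x $ 3)\<^sup>2) has_derivative (\<lambda>v. 2 * x $ 3 * v $ 3)) (at x)"
    by (auto intro!: derivative_eq_intros n)
  have 2: "((\<lambda>x::real^4. (x $ 3 + \<beta> * x $ 4)\<^sup>2) has_derivative
      (\<lambda>v. 2 * (x $ 3 + \<beta> * x $ 4) * (v $ 3 + \<beta> * v $ 4))) (at x)"
    by (auto intro!: derivative_eq_intros n simp: fun_eq_iff algebra_simps)
  consider "i \<noteq> j" | "i = j" "i = 1" | "i = j" "i = 2" | "i = j" "i \<noteq> 1" "i \<noteq> 2"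
    by blast
  then show ?thesis
  proof cases
    case 2
    then have "(\<lambda>x. g_beta \<beta> x $ i $ j) = (\<lambda>x. (x $ 3)\<^sup>2)"
      by (simp add: g_beta_def)
    then show ?thesis
      using 2 by (simp add: metric_partial_def frechet_derivative_at[OF 1, symmetric] axis_def)
  next
    case 3
    then have "(\<lambda>x. g_beta \<beta> x $ i $ j) = (\<lambda>x. (x $ 3 + \<beta> * x $ 4)\<^sup>2)"
      by (simp add: g_beta_def)
    then show ?thesis
      using 3 by (simp add: metric_partial_def frechet_derivative_at[OF 2, symmetric] axis_def)
  qed (simp_all add: metric_partial_def g_beta_def)
qed

text \<open>
  The listed symbols are symmetric and compatible with the metric, and these properties characterise
  the Christoffel symbols.
\<close>

lemma g_beta_christoffel:
  assumes x: "x \<in> quadrant" and \<beta>: "\<beta> > 0"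
  defines "a \<equiv> x $ 3" and "b \<equiv> x $ 3 + \<beta> * x $ 4"
  shows "christoffel (g_beta \<beta>) x = (\<lambda>i j k.
    if k = 1 then (if i = 1 \<and> j = 3 \<or> i = 3 \<and> j = 1 then 1 / a else 0)
    else if k = 2 then (if i = 2 \<and> j = 3 \<or> i = 3 \<and> j = 2 then 1 / b
                        else if i = 2 \<and> j = 4 \<or> i = 4 \<and> j = 2 then \<beta> / b else 0)
    else if k = 3 then (if i = 1 \<and> j = 1 then - a else if i = 2 \<and> j = 2 then - b else 0)
    else (if i = 2 \<and> j = 2 then - \<beta> * b else 0))" (is "_ = ?\<Gamma>")
proof -
  have pos: "a > 0" "b > 0"
    using quadrant_pos[OF x \<beta>] by (auto simp: a_def b_def)
  have "\<forall>i j k. ?\<Gamma> i j k = ?\<Gamma> j i k"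
    by (auto simp: forall_4)
  moreover have "\<forall>i j k. metric_partial (g_beta \<beta>) x k i j =
      (\<Sum>l\<in>UNIV. ?\<Gamma> k i l * g_beta \<beta> x $ l $ j) + (\<Sum>l\<in>UNIV. ?\<Gamma> k j l * g_beta \<beta> x $ i $ l)"
    unfolding g_beta_partial g_beta_def b_def[symmetric] vec_lambda_beta
    unfolding a_def[symmetric]
    using pos by (simp add: forall_4 sum_4 power2_eq_square)
  ultimately show ?thesis
    using levi_civita_unique[OF g_beta_pseudo[OF \<beta>] x, of ?\<Gamma>] by simp
qed

lemma g_beta_connection_form:
  assumes x: "x \<in> quadrant" and \<beta>: "\<beta> > 0"
  shows "connection_form (g_beta \<beta>) x u v = (\<chi> k.
    if k = 1 then (u $ 1 * v $ 3 + u $ 3 * v $ 1) / x $ 3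
    else if k = 2 then (u $ 2 * (v $ 3 + \<beta> * v $ 4) + (u $ 3 + \<beta> * u $ 4) * v $ 2) / (x $ 3 + \<beta> * x $ 4)
    else if k = 3 then - (x $ 3 * (u $ 1 * v $ 1)) - (x $ 3 + \<beta> * x $ 4) * (u $ 2 * v $ 2)
    else - (\<beta> * (x $ 3 + \<beta> * x $ 4) * (u $ 2 * v $ 2)))"
  unfolding connection_form_def g_beta_christoffel[OF assms]
  by (simp add: vec_eq_iff forall_4 sum_4 add_divide_distrib algebra_simps)

lemma has_derivative_vec_componentwise:
  fixes f :: "'a::real_normed_vector \<Rightarrow> real^'n"
  assumes "\<And>k. ((\<lambda>x. f x $ k) has_derivative (\<lambda>v. f' v $ k)) (at p)"
  shows "(f has_derivative f') (at p)"
  using assms by (subst has_derivative_componentwise_within) (auto simp: Basis_vec_def inner_axis)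

lemma g_beta_connection_form_derivative:
  assumes x: "x \<in> quadrant" and \<beta>: "\<beta> > 0"
  shows "frechet_derivative (\<lambda>q. connection_form (g_beta \<beta>) q u v) (at x) w = (\<chi> k.
    if k = 1 then - ((u $ 1 * v $ 3 + u $ 3 * v $ 1) * w $ 3 / (x $ 3)\<^sup>2)
    else if k = 2 then - ((u $ 2 * (v $ 3 + \<beta> * v $ 4) + (u $ 3 + \<beta> * u $ 4) * v $ 2)
        * (w $ 3 + \<beta> * w $ 4) / (x $ 3 + \<beta> * x $ 4)\<^sup>2)
    else if k = 3 then - (w $ 3 * (u $ 1 * v $ 1)) - (w $ 3 + \<beta> * w $ 4) * (u $ 2 * v $ 2)
    else - (\<beta> * (w $ 3 + \<beta> * w $ 4) * (u $ 2 * v $ 2)))" (is "_ = ?D w")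
proof -
  let ?f = "\<lambda>x. \<chi> k::4.
    if k = 1 then (u $ 1 * v $ 3 + u $ 3 * v $ 1) / x $ 3
    else if k = 2 then (u $ 2 * (v $ 3 + \<beta> * v $ 4) + (u $ 3 + \<beta> * u $ 4) * v $ 2) / (x $ 3 + \<beta> * x $ 4)
    else if k = 3 then - (x $ 3 * (u $ 1 * v $ 1)) - (x $ 3 + \<beta> * x $ 4) * (u $ 2 * v $ 2)
    else - (\<beta> * (x $ 3 + \<beta> * x $ 4) * (u $ 2 * v $ 2))"
  have pos: "x $ 3 \<noteq> 0" "x $ 3 + \<beta> * x $ 4 \<noteq> 0"
    using quadrant_pos[OF x \<beta>] by auto
  have n: "((\<lambda>x::real^4. x $ m) has_derivative (\<lambda>v. v $ m)) (at x)" for m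
    by (rule bounded_linear_imp_has_derivative[OF bounded_linear_vec_nth])
  have D1: "((\<lambda>x::real^4. c / x $ 3) has_derivative (\<lambda>w. - (c * w $ 3 / (x $ 3)\<^sup>2))) (at x)" for c
    using pos by (auto intro!: derivative_eq_intros n simp: power2_eq_square field_simps)
  have D2: "((\<lambda>x::real^4. c / (x $ 3 + \<beta> * x $ 4)) has_derivative
      (\<lambda>w. - (c * (w $ 3 + \<beta> * w $ 4) / (x $ 3 + \<beta> * x $ 4)\<^sup>2))) (at x)" for c
    using pos by (auto intro!: derivative_eq_intros n simp: power2_eq_square divide_simps)
  have D3: "((\<lambda>x::real^4. - (x $ 3 * c) - (x $ 3 + \<beta> * x $ 4) * d) has_derivative
      (\<lambda>w. - (w $ 3 * c) - (w $ 3 + \<beta> * w $ 4) * d)) (at x)" for c d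
    by (auto intro!: derivative_eq_intros n)
  have D4: "((\<lambda>x::real^4. - (\<beta> * (x $ 3 + \<beta> * x $ 4) * d)) has_derivative
      (\<lambda>w. - (\<beta> * (w $ 3 + \<beta> * w $ 4) * d))) (at x)" for d
    by (auto intro!: derivative_eq_intros n)
  have "(?f has_derivative ?D) (at x)"
  proof (rule has_derivative_vec_componentwise)
    fix k :: 4
    show "((\<lambda>x. ?f x $ k) has_derivative (\<lambda>w. ?D w $ k)) (at x)"
      using exhaust_4[of k] D1 D2 D3 D4 by auto
  qed
  then have "((\<lambda>q. connection_form (g_beta \<beta>) q u v) has_derivative ?D) (at x)"
    by (rule has_derivative_transform_within_open[OF _ open_quadrant x])
      (simp add: g_beta_connection_form[OF _ \<beta>])
  then show ?thesis
    by (rule fun_cong[OF sym[OF frechet_derivative_at]])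
qed

text \<open>
  All curvature operators are multiples of one rotation of the plane of \<open>\<partial>\<^sub>1\<close> and \<open>\<partial>\<^sub>2\<close>: with respect
  to the orthonormal vectors \<open>\<partial>\<^sub>1 / a\<close> and \<open>\<partial>\<^sub>2 / b\<close>, the vector on the right has components \<open>- w\<^sub>2\<close> and
  \<open>w\<^sub>1\<close> if those of \<open>w\<close> are \<open>w\<^sub>1\<close> and \<open>w\<^sub>2\<close>.
\<close>

theorem g_beta_curvature:
  assumes x: "x \<in> quadrant" and \<beta>: "\<beta> > 0"
  defines "a \<equiv> x $ 3" and "b \<equiv> x $ 3 + \<beta> * x $ 4"
  shows "curvature_operator (g_beta \<beta>) x u v w =
    (u $ 1 * v $ 2 - u $ 2 * v $ 1) *\<^sub>R (\<chi> k. if k = 1 then - (b / a) * w $ 2 else if k = 2 then a / b * w $ 1 else 0)"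
proof -
  have pos: "a \<noteq> 0" "b \<noteq> 0"
    using quadrant_pos[OF x \<beta>] by (auto simp: a_def b_def)
  show ?thesis
    unfolding curvature_operator_eq g_beta_connection_form[OF x \<beta>] g_beta_connection_form_derivative[OF x \<beta>]
      b_def[symmetric] unfolding a_def[symmetric]
    using pos by (simp add: vec_eq_iff forall_4 power2_eq_square divide_simps) (auto simp: algebra_simps)
qed

corollary g_beta_skew_tsankov:
  assumes "\<beta> > 0"
  shows "skew_tsankov quadrant (g_beta \<beta>)"
  unfolding skew_tsankov_def
  by (auto simp: g_beta_curvature[OF _ assms] fun_eq_iff vec_eq_iff forall_4)

text \<open>
  The inverse metric is diagonal, so only the terms \<open>R(\<partial>\<^sub>i, \<partial>\<^sub>j, \<partial>\<^sub>j, \<partial>\<^sub>i)\<close> contribute, and of these only the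
  two with \<open>{i, j} = {1, 2}\<close>, each of which is \<open>- a b\<close>.
\<close>

corollary g_beta_scalar_curvature:
  assumes x: "x \<in> quadrant" and \<beta>: "\<beta> > 0"
  shows "scalar_curvature (g_beta \<beta>) x = - 2 * inverse (x $ 3) * inverse (x $ 3 + \<beta> * x $ 4)"
proof -
  have inv: "matrix_inv (g_beta \<beta> x) $ i $ l = (if i = l then inverse (g_beta \<beta> x $ i $ i) else 0)" for i l
    by (simp add: matrix_inv_g_beta[OF assms] g_beta_inv_def)
  let ?R = "\<lambda>i j k l. curvature_tensor (g_beta \<beta>) x (axis i 1) (axis j 1) (axis k 1) (axis l 1)"
  have l: "(\<Sum>l\<in>UNIV. matrix_inv (g_beta \<beta> x) $ i $ l * c * f l) = inverse (g_beta \<beta> x $ i $ i) * c * f i" for i c f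
  proof -
    have "(\<Sum>l\<in>UNIV. matrix_inv (g_beta \<beta> x) $ i $ l * c * f l) =
        (\<Sum>l\<in>UNIV. if l = i then inverse (g_beta \<beta> x $ i $ i) * c * f i else 0)"
      unfolding inv by (intro sum.cong) auto
    then show ?thesis by simp
  qed
  have "(\<Sum>k\<in>UNIV. inverse (g_beta \<beta> x $ i $ i) * matrix_inv (g_beta \<beta> x) $ j $ k * ?R i j k i) =
      inverse (g_beta \<beta> x $ i $ i) * inverse (g_beta \<beta> x $ j $ j) * ?R i j j i" for i j
    using l[of j "inverse (g_beta \<beta> x $ i $ i)" "\<lambda>k. ?R i j k i"] by (simp only: mult.commute mult.left_commute)
  then have "scalar_curvature (g_beta \<beta>) x =
      (\<Sum>i\<in>UNIV. \<Sum>j\<in>UNIV. inverse (g_beta \<beta> x $ i $ i) * inverse (g_beta \<beta> x $ j $ j) * ?R i j j i)"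
    unfolding scalar_curvature_def l by (simp only:)
  also have "\<dots> = - 2 * inverse (x $ 3) * inverse (x $ 3 + \<beta> * x $ 4)"
  proof -
    define a b where "a = x $ 3" and "b = x $ 3 + \<beta> * x $ 4"
    have pos: "a > 0" "b > 0"
      using quadrant_pos[OF assms] by (auto simp: a_def b_def)
    have "?R i j j i = (if i = 1 \<and> j = 2 \<or> i = 2 \<and> j = 1 then - (a * b) else 0)" for i j
      unfolding curvature_tensor_def g_beta_form g_beta_curvature[OF assms] b_def[symmetric]
      unfolding a_def[symmetric]
      using pos exhaust_4[of i] exhaust_4[of j] by (auto simp: axis_def power2_eq_square)
    then show ?thesis
      unfolding g_beta_def b_def[symmetric] vec_lambda_beta unfolding a_def[symmetric]
      using pos by (simp add: sum_4 power2_eq_square field_simps)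
  qed
  finally show ?thesis .
qed

section \<open>Irreducibility\<close>

lemma g_beta_connection_form_axis:
  assumes x: "x \<in> quadrant" and \<beta>: "\<beta> > 0"
  defines "a \<equiv> x $ 3" and "b \<equiv> x $ 3 + \<beta> * x $ 4"
  shows "connection_form (g_beta \<beta>) x (axis 1 1) (axis 1 1) = - a *\<^sub>R axis 3 1"
    and "connection_form (g_beta \<beta>) x (axis 1 1) (axis 3 1) = (1 / a) *\<^sub>R axis 1 1"
    and "connection_form (g_beta \<beta>) x (axis 1 1) (axis 4 1) = 0"
    and "connection_form (g_beta \<beta>) x (axis 2 1) (axis 2 1) = - b *\<^sub>R axis 3 1 - (\<beta> * b) *\<^sub>R axis 4 1"
    and "connection_form (g_beta \<beta>) x (axis 2 1) (axis 4 1) = (\<beta> / b) *\<^sub>R axis 2 1"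
  by (simp_all add: g_beta_connection_form[OF x \<beta>] vec_eq_iff forall_4 axis_def a_def b_def)

lemma g_beta_curvature_axis:
  assumes x: "x \<in> quadrant" and \<beta>: "\<beta> > 0"
  defines "a \<equiv> x $ 3" and "b \<equiv> x $ 3 + \<beta> * x $ 4"
  defines "R \<equiv> curvature_operator (g_beta \<beta>) x (axis 1 1) (axis 2 1)"
  shows "R (axis 1 1) = (a / b) *\<^sub>R axis 2 1" "R (axis 2 1) = - (b / a) *\<^sub>R axis 1 1"
    and "R (axis 3 1) = 0" "R (axis 4 1) = 0"
  by (simp_all add: R_def g_beta_curvature[OF x \<beta>] vec_eq_iff forall_4 axis_def a_def b_def)

lemma g_beta_curvature_skew:
  assumes x: "x \<in> quadrant" and \<beta>: "\<beta> > 0"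
  shows "metric_form (g_beta \<beta>) x (curvature_operator (g_beta \<beta>) x u v w) z =
    - metric_form (g_beta \<beta>) x w (curvature_operator (g_beta \<beta>) x u v z)"
proof -
  define a b where "a = x $ 3" and "b = x $ 3 + \<beta> * x $ 4"
  have pos: "a > 0" "b > 0"
    using quadrant_pos[OF assms] by (auto simp: a_def b_def)
  show ?thesis
    unfolding g_beta_form g_beta_curvature[OF assms] b_def[symmetric]
    unfolding a_def[symmetric]
    using pos by (simp add: power2_eq_square divide_simps)
qed

lemma g_beta_form_commute: "metric_form (g_beta \<beta>) x v w = metric_form (g_beta \<beta>) x w v"
  by (simp add: g_beta_form)

text \<open>
  The proof works with the components of the symmetric bilinear form \<open>Q(v, w) = g(E v, w)\<close>. Since \<open>E\<close>
  commutes with the curvature operators, these are skew for \<open>Q\<close>; that determines the components with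
  an index 1 or 2 up to one factor \<open>c\<close>. The others follow by differentiating components that vanish
  identically.
\<close>

theorem g_beta_irreducible:
  assumes \<beta>: "\<beta> > 0"
  shows "irreducible_manifold quadrant (g_beta \<beta>)"
  unfolding irreducible_manifold_def
proof (intro ballI notI)
  fix P
  assume "reducible_at quadrant (g_beta \<beta>) P"
  let ?g = "g_beta \<beta>"
  obtain U E where U: "open U" "P \<in> U" "U \<subseteq> quadrant"
    and adj: "\<And>x v w. x \<in> U \<Longrightarrow> metric_form ?g x (E x v) w = metric_form ?g x v (E x w)"
    and par: "\<And>x v w. x \<in> U \<Longrightarrow> ((\<lambda>y. metric_form ?g y (E y v) w) has_derivative
          (\<lambda>u. metric_form ?g x (E x (connection_form ?g x u v)) w
             + metric_form ?g x (E x v) (connection_form ?g x u w))) (at x)"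
    and curv: "\<And>x a b c. x \<in> U \<Longrightarrow> E x (curvature_operator ?g x a b c) = curvature_operator ?g x a b (E x c)"
    and nonscalar: "\<And>x c. x \<in> U \<Longrightarrow> \<exists>v. E x v \<noteq> c *\<^sub>R v"
    by (rule reducible_imp_parallel_endomorphism[OF g_beta_pseudo[OF \<beta>] \<open>reducible_at quadrant ?g P\<close>])
      (rule that)
  define Q where "Q x v w = metric_form ?g x (E x v) w" for x v w
  have sym: "Q x v w = Q x w v" if "x \<in> U" for x v w
    using adj[OF that, of v w] g_beta_form_commute[of \<beta> x v] by (simp add: Q_def)
  have bil: "bilinear (Q x)" if "x \<in> U" for x
  proof -
    have l: "linear (Q x v)" for v
      unfolding Q_def by (rule bilinear_linear_arg(2)[OF bilinear_metric_form])
    moreover have "linear (\<lambda>v. Q x v w)" for w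
      using l[of w] by (simp add: sym[OF that, of _ w])
    ultimately show ?thesis
      by (simp add: bilinear_def)
  qed
  let ?e1 = "axis 1 1 :: real^4" and ?e2 = "axis 2 1 :: real^4"
    and ?e3 = "axis 3 1 :: real^4" and ?e4 = "axis 4 1 :: real^4"
  have pos: "x $ 3 > 0" "x $ 3 + \<beta> * x $ 4 > 0" if "x \<in> U" for x
    using quadrant_pos[OF _ \<beta>] U that by auto
  have off: "Q x ?e1 ?e2 = 0" "Q x ?e1 ?e3 = 0" "Q x ?e1 ?e4 = 0" "Q x ?e2 ?e3 = 0" "Q x ?e2 ?e4 = 0"
      "Q x ?e2 ?e2 * (x $ 3)\<^sup>2 = Q x ?e1 ?e1 * (x $ 3 + \<beta> * x $ 4)\<^sup>2" if x: "x \<in> U" for x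
  proof -
    have xq: "x \<in> quadrant" using x U by blast
    define a b where "a = x $ 3" and "b = x $ 3 + \<beta> * x $ 4"
    have ab: "a > 0" "b > 0" using pos[OF x] by (auto simp: a_def b_def)
    let ?R = "curvature_operator ?g x ?e1 ?e2"
    have skew: "Q x (?R v) w = - Q x v (?R w)" for v w
      by (simp add: Q_def curv[OF x] g_beta_curvature_skew[OF xq \<beta>])
    note R = g_beta_curvature_axis[OF xq \<beta>, folded b_def, folded a_def]
    note B = bilinear_lmul[OF bil[OF x]] bilinear_rmul[OF bil[OF x]] bilinear_rzero[OF bil[OF x]]
      bilinear_lneg[OF bil[OF x]] bilinear_rneg[OF bil[OF x]]
    show "Q x ?e1 ?e2 = 0"
      using skew[of ?e1 ?e1] ab by (simp add: R B sym[OF x, of ?e2 ?e1])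
    show "Q x ?e1 ?e3 = 0" using skew[of ?e2 ?e3] ab by (simp add: R B)
    show "Q x ?e1 ?e4 = 0" using skew[of ?e2 ?e4] ab by (simp add: R B)
    show "Q x ?e2 ?e3 = 0" using skew[of ?e1 ?e3] ab by (simp add: R B)
    show "Q x ?e2 ?e4 = 0" using skew[of ?e1 ?e4] ab by (simp add: R B)
    have "Q x ?e2 ?e2 * a\<^sup>2 = Q x ?e1 ?e1 * b\<^sup>2"
      using skew[of ?e1 ?e2] ab by (simp add: R B field_simps power2_eq_square)
    then show "Q x ?e2 ?e2 * (x $ 3)\<^sup>2 = Q x ?e1 ?e1 * (x $ 3 + \<beta> * x $ 4)\<^sup>2"
      by (simp add: a_def b_def)
  qed
  \<comment> \<open>A component of \<open>Q\<close> that vanishes on all of \<open>U\<close> has derivative zero, which is an algebraic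
     relation between the components, as \<open>Q\<close> is parallel.\<close>
  have diff: "Q x (connection_form ?g x u v) w + Q x v (connection_form ?g x u w) = 0"
    if x: "x \<in> U" and zero: "\<And>y. y \<in> U \<Longrightarrow> Q y v w = 0" for x u v w
  proof -
    have "((\<lambda>y. 0) has_derivative
        (\<lambda>u. Q x (connection_form ?g x u v) w + Q x v (connection_form ?g x u w))) (at x)"
      using par[OF x, of v w] unfolding Q_def[symmetric]
      by (rule has_derivative_transform_within_open[OF _ U(1) x]) (rule zero)
    from has_derivative_unique[OF this has_derivative_const] show ?thesis
      by (rule fun_cong)
  qed
  define a b where "a = P $ 3" and "b = P $ 3 + \<beta> * P $ 4"
  have ab: "a > 0" "b > 0" using pos[OF U(2)] by (auto simp: a_def b_def)
  have Pq: "P \<in> quadrant" using U by blast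
  note C = g_beta_connection_form_axis[OF Pq \<beta>, folded b_def, folded a_def]
  note B = bilinear_lmul[OF bil[OF U(2)]] bilinear_rmul[OF bil[OF U(2)]]
    bilinear_lsub[OF bil[OF U(2)]] bilinear_rsub[OF bil[OF U(2)]]
    bilinear_lzero[OF bil[OF U(2)]] bilinear_rzero[OF bil[OF U(2)]]
    bilinear_lneg[OF bil[OF U(2)]] bilinear_rneg[OF bil[OF U(2)]]
  define c where "c = Q P ?e1 ?e1 / a\<^sup>2"
  have Q11: "Q P ?e1 ?e1 = c * a\<^sup>2"
    using ab by (simp add: c_def)
  have Q22: "Q P ?e2 ?e2 = c * b\<^sup>2"
    using off(6)[OF U(2), folded b_def, folded a_def] ab by (simp add: Q11)
  \<comment> \<open>\<open>\<nabla>\<^sub>1 Q\<^sub>1\<^sub>3 = 0\<close> reads \<open>- a Q\<^sub>3\<^sub>3 + Q\<^sub>1\<^sub>1 / a = 0\<close>.\<close>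
  have Q33: "Q P ?e3 ?e3 = c"
    using diff[OF U(2) off(2), of ?e1] ab by (simp add: C B Q11 power2_eq_square)
  \<comment> \<open>\<open>\<nabla>\<^sub>1 Q\<^sub>1\<^sub>4 = 0\<close> reads \<open>- a Q\<^sub>3\<^sub>4 = 0\<close>.\<close>
  have Q34: "Q P ?e3 ?e4 = 0"
    using diff[OF U(2) off(3), of ?e1] ab by (simp add: C B)
  \<comment> \<open>\<open>\<nabla>\<^sub>2 Q\<^sub>2\<^sub>4 = 0\<close> reads \<open>- b Q\<^sub>3\<^sub>4 - \<beta> b Q\<^sub>4\<^sub>4 + (\<beta> / b) Q\<^sub>2\<^sub>2 = 0\<close>; here \<open>\<beta> \<noteq> 0\<close> is needed.\<close>
  have Q44: "Q P ?e4 ?e4 = c"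
    using diff[OF U(2) off(5), of ?e2] ab \<beta> by (simp add: C B Q22 Q34 power2_eq_square)
  have "Q P = (\<lambda>v w. c * metric_form ?g P v w)"
  proof (rule bilinear_eq_stdbasis[OF bil[OF U(2)]])
    show "bilinear (\<lambda>v w. c * metric_form ?g P v w)"
      unfolding bilinear_def
      using bilinear_linear_arg[OF bilinear_metric_form, of ?g P]
      by (auto intro!: linear_compose_scale_right[where 'b = real, unfolded real_scaleR_def])
    show "Q P v w = c * metric_form ?g P v w" if basis: "v \<in> Basis" "w \<in> Basis" for v w
    proof -
      obtain i j where ij: "v = axis i 1" "w = axis j 1"
        using basis by (auto simp: Basis_vec_def)
      show ?thesis
        unfolding ij metric_form_axis(3) g_beta_def b_def[symmetric] vec_lambda_beta
        unfolding a_def[symmetric]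
        using exhaust_4[of i] exhaust_4[of j] off(1-5)[OF U(2)] Q11 Q22 Q33 Q34 Q44
          sym[OF U(2), of ?e2 ?e1] sym[OF U(2), of ?e3 ?e1] sym[OF U(2), of ?e4 ?e1]
          sym[OF U(2), of ?e3 ?e2] sym[OF U(2), of ?e4 ?e2] sym[OF U(2), of ?e4 ?e3]
        by (elim disjE) simp_all
    qed
  qed
  then have Q: "metric_form ?g P (E P v) w = c * metric_form ?g P v w" for v w
    by (simp add: Q_def fun_eq_iff)
  obtain v where v: "E P v \<noteq> c *\<^sub>R v"
    using nonscalar[OF U(2)] by blast
  let ?d = "E P v - c *\<^sub>R v"
  have "metric_form ?g P ?d ?d = metric_form ?g P (E P v) ?d - c * metric_form ?g P v ?d"
    by (simp only: bilinear_lsub[OF bilinear_metric_form] bilinear_lmul[OF bilinear_metric_form] real_scaleR_def)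
  then have "metric_form ?g P ?d ?d = 0"
    by (simp add: Q)
  moreover have "metric_form ?g P ?d ?d > 0"
    using g_beta_riemannian[OF \<beta>] Pq v unfolding riemannian_manifold_def by auto
  ultimately show False
    by simp
qed

section \<open>Isometry classes\<close>

text \<open>
  The area density \<open>a b\<close> of the surfaces on which \<open>x\<^sub>3\<close> and \<open>x\<^sub>4\<close> are constant. Up to the factor \<open>- 2\<close> it is
  the reciprocal of the scalar curvature, and \<open>area_grad_sq\<close> is the squared norm of its gradient,
  \<open>(a + b)\<^sup>2 + \<beta>\<^sup>2 a\<^sup>2\<close>.
\<close>

definition area :: "real \<Rightarrow> real^4 \<Rightarrow> real" where
  "area \<beta> x = x $ 3 * (x $ 3 + \<beta> * x $ 4)"

definition area_grad_sq :: "real \<Rightarrow> real^4 \<Rightarrow> real" where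
  "area_grad_sq \<beta> x = (2 * x $ 3 + \<beta> * x $ 4)\<^sup>2 + (\<beta> * x $ 3)\<^sup>2"

lemma area_has_derivative:
  "(area \<beta> has_derivative (\<lambda>v. (2 * x $ 3 + \<beta> * x $ 4) * v $ 3 + \<beta> * x $ 3 * v $ 4)) (at x)"
proof -
  have n: "((\<lambda>x::real^4. x $ m) has_derivative (\<lambda>v. v $ m)) (at x)" for m
    by (rule bounded_linear_imp_has_derivative[OF bounded_linear_vec_nth])
  show ?thesis
    unfolding area_def by (auto intro!: derivative_eq_intros n simp: algebra_simps)
qed

lemma area_pos: "x \<in> quadrant \<Longrightarrow> \<beta> > 0 \<Longrightarrow> area \<beta> x > 0"
  using quadrant_pos[of x \<beta>] by (simp add: area_def)

text \<open>
  Lagrange's identity for the weighted inner product: the Gram determinant is the sum of the weighted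
  squares of all \<open>2 \<times> 2\<close> minors, of which only the first is kept.
\<close>

lemma g_beta_gram:
  "(area \<beta> x)\<^sup>2 * (v $ 1 * w $ 2 - v $ 2 * w $ 1)\<^sup>2 \<le>
    metric_form (g_beta \<beta>) x v v * metric_form (g_beta \<beta>) x w w - (metric_form (g_beta \<beta>) x v w)\<^sup>2"
proof -
  define a b where "a = x $ 3" and "b = x $ 3 + \<beta> * x $ 4"
  let ?m = "\<lambda>i j. v $ i * w $ j - v $ j * w $ i"
  have "metric_form (g_beta \<beta>) x v v * metric_form (g_beta \<beta>) x w w - (metric_form (g_beta \<beta>) x v w)\<^sup>2 =
      (a * b)\<^sup>2 * (?m 1 2)\<^sup>2 + (a * ?m 1 3)\<^sup>2 + (a * ?m 1 4)\<^sup>2 + (b * ?m 2 3)\<^sup>2 + (b * ?m 2 4)\<^sup>2 + (?m 3 4)\<^sup>2"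
    unfolding g_beta_form b_def[symmetric] unfolding a_def[symmetric]
    by algebra
  also have "\<dots> \<ge> (a * b)\<^sup>2 * (?m 1 2)\<^sup>2"
    by simp
  finally show ?thesis
    by (simp add: area_def a_def b_def)
qed

lemma g_beta_sectional:
  assumes "x \<in> quadrant" "\<beta> > 0"
  shows "curvature_tensor (g_beta \<beta>) x v w w v = - area \<beta> x * (v $ 1 * w $ 2 - v $ 2 * w $ 1)\<^sup>2"
proof -
  define a b where "a = x $ 3" and "b = x $ 3 + \<beta> * x $ 4"
  have pos: "a > 0" "b > 0"
    using quadrant_pos[OF assms] by (auto simp: a_def b_def)
  show ?thesis
    unfolding curvature_tensor_def g_beta_form g_beta_curvature[OF assms] area_def b_def[symmetric]
    unfolding a_def[symmetric]
    using pos by (simp add: power2_eq_square divide_simps) (simp add: algebra_simps)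
qed

text \<open>
  By \<open>g_beta_gram\<close> and \<open>g_beta_sectional\<close>, all sectional curvatures at \<open>q\<close> are at least \<open>- 1 / area\<close>, while
  the plane of the first two coordinate vectors at \<open>p\<close> attains this bound. A map \<open>L\<close> of the tangent
  spaces that preserves metric and curvature therefore compares the two values.
\<close>

lemma area_le:
  assumes p: "p \<in> quadrant" "\<beta> > 0" and q: "q \<in> quadrant" "\<gamma> > 0"
    and L: "\<And>v w. metric_form (g_beta \<gamma>) q (L v) (L w) = metric_form (g_beta \<beta>) p v w"
    and R: "\<And>u v w. curvature_operator (g_beta \<gamma>) q (L u) (L v) (L w) = L (curvature_operator (g_beta \<beta>) p u v w)"
  shows "area \<gamma> q \<le> area \<beta> p"
proof -
  let ?v = "L (axis 1 1)" and ?w = "L (axis 2 1)"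
  let ?\<omega> = "?v $ 1 * ?w $ 2 - ?v $ 2 * ?w $ 1"
  have "curvature_tensor (g_beta \<gamma>) q ?v ?w ?w ?v =
      curvature_tensor (g_beta \<beta>) p (axis 1 1) (axis 2 1) (axis 2 1) (axis 1 1)"
    by (simp add: curvature_tensor_def R L)
  then have "area \<gamma> q * ?\<omega>\<^sup>2 = area \<beta> p"
    by (simp add: g_beta_sectional[OF p] g_beta_sectional[OF q] axis_def)
  then have "area \<gamma> q * area \<beta> p = (area \<gamma> q)\<^sup>2 * ?\<omega>\<^sup>2"
    by (simp add: power2_eq_square)
  also have "\<dots> \<le> (area \<beta> p)\<^sup>2"
    using g_beta_gram[of \<gamma> q ?v ?w] unfolding L
    by (simp add: g_beta_form axis_def area_def power_mult_distrib)
  finally show ?thesis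
    using area_pos[OF p] by (simp add: power2_eq_square)
qed

text \<open>
  The squared norm of the gradient is the least constant in the Cauchy-Schwarz inequality for the
  differential, and equality holds for the gradient vector. It is compared along \<open>L\<close> as in \<open>area_le\<close>.
\<close>

lemma area_grad_sq_le:
  assumes L: "\<And>v w. metric_form (g_beta \<gamma>) q (L v) (L w) = metric_form (g_beta \<beta>) p v w"
    and d: "\<And>v. frechet_derivative (area \<gamma>) (at q) (L v) = frechet_derivative (area \<beta>) (at p) v"
    and pos: "area_grad_sq \<beta> p > 0"
  shows "area_grad_sq \<beta> p \<le> area_grad_sq \<gamma> q"
proof -
  let ?D = "\<lambda>\<delta> (x::real^4) (v::real^4). (2 * x $ 3 + \<delta> * x $ 4) * v $ 3 + \<delta> * x $ 3 * v $ 4"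
  have fd: "frechet_derivative (area \<delta>) (at x) v = ?D \<delta> x v" for \<delta> x v
    by (rule fun_cong[OF sym[OF frechet_derivative_at[OF area_has_derivative]]])
  have cs: "(?D \<delta> x v)\<^sup>2 \<le> area_grad_sq \<delta> x * metric_form (g_beta \<delta>) x v v" for \<delta> x v
  proof -
    define a b m n where "a = x $ 3" and "b = x $ 3 + \<delta> * x $ 4" and "m = 2 * x $ 3 + \<delta> * x $ 4" and "n = \<delta> * x $ 3"
    have "(m\<^sup>2 + n\<^sup>2) * (a\<^sup>2 * v $ 1 * v $ 1 + b\<^sup>2 * v $ 2 * v $ 2 + v $ 3 * v $ 3 + v $ 4 * v $ 4) - (m * v $ 3 + n * v $ 4)\<^sup>2 =
        (m\<^sup>2 + n\<^sup>2) * ((a * v $ 1)\<^sup>2 + (b * v $ 2)\<^sup>2) + (m * v $ 4 - n * v $ 3)\<^sup>2"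
      by algebra
    also have "\<dots> \<ge> 0"
      by simp
    finally show ?thesis
      by (simp add: area_grad_sq_def g_beta_form a_def b_def m_def n_def)
  qed
  define v :: "real^4" where "v = (\<chi> k. if k = 3 then 2 * p $ 3 + \<beta> * p $ 4 else if k = 4 then \<beta> * p $ 3 else 0)"
  have Dv: "?D \<beta> p v = area_grad_sq \<beta> p" and gv: "metric_form (g_beta \<beta>) p v v = area_grad_sq \<beta> p"
    by (simp_all add: v_def area_grad_sq_def g_beta_form power2_eq_square)
  have "(area_grad_sq \<beta> p)\<^sup>2 = (?D \<gamma> q (L v))\<^sup>2"
    using d[of v] by (simp only: fd Dv)
  also have "\<dots> \<le> area_grad_sq \<gamma> q * area_grad_sq \<beta> p"
    using cs[where \<delta> = \<gamma> and x = q and v = "L v"] by (simp only: L gv)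
  finally show ?thesis
    using pos by (simp add: power2_eq_square)
qed

lemma area_grad_sq_pos: "x \<in> quadrant \<Longrightarrow> \<beta> > 0 \<Longrightarrow> area_grad_sq \<beta> x > 0"
  using quadrant_pos[of x \<beta>] unfolding area_grad_sq_def
  by (intro add_pos_pos zero_less_power mult_pos_pos) simp_all

text \<open>
  Both comparison lemmas are applied to the derivative of the isometry and to its inverse.
\<close>

lemma isometry_preserves_area:
  assumes pos: "\<beta> > 0" "\<gamma> > 0" and iso: "isometry quadrant (g_beta \<beta>) quadrant (g_beta \<gamma>) \<phi>"
    and p: "p \<in> quadrant"
  shows "area \<gamma> (\<phi> p) = area \<beta> p" "area_grad_sq \<gamma> (\<phi> p) = area_grad_sq \<beta> p"
proof -
  interpret metric_isometry quadrant "g_beta \<beta>" quadrant "g_beta \<gamma>" \<phi>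
    by unfold_locales (use g_beta_pseudo pos iso in auto)
  have area: "area \<gamma> (\<phi> x) = area \<beta> x" if x: "x \<in> quadrant" for x
  proof (rule antisym)
    obtain G where G: "\<And>v. G (F x v) = v" "\<And>w. F x (G w) = w"
      using F_inverse[OF x] by metis
    show "area \<gamma> (\<phi> x) \<le> area \<beta> x"
      by (rule area_le[OF x pos(1) maps_into[OF x] pos(2) F_isometric[OF x] curvature_natural[OF x]])
    show "area \<beta> x \<le> area \<gamma> (\<phi> x)"
    proof (rule area_le[OF maps_into[OF x] pos(2) x pos(1)])
      show "metric_form (g_beta \<beta>) x (G v) (G w) = metric_form (g_beta \<gamma>) (\<phi> x) v w" for v w
        using F_isometric[OF x, of "G v" "G w"] by (simp add: G)
      show "curvature_operator (g_beta \<beta>) x (G u) (G v) (G w) =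
          G (curvature_operator (g_beta \<gamma>) (\<phi> x) u v w)" for u v w
        using arg_cong[where f = G, OF curvature_natural[OF x, of "G u" "G v" "G w"]] by (simp add: G)
    qed
  qed
  then show "area \<gamma> (\<phi> p) = area \<beta> p"
    using p .
  have D: "(area \<beta> has_derivative frechet_derivative (area \<beta>) (at x)) (at x)" for \<beta> x
    by (rule has_derivative_frechet_derivativeI[OF area_has_derivative])
  have "((\<lambda>x. area \<gamma> (\<phi> x)) has_derivative (\<lambda>v. frechet_derivative (area \<gamma>) (at (\<phi> p)) (F p v))) (at p)"
    by (rule has_derivative_compose[OF deriv[OF p] D])
  then have "(area \<beta> has_derivative (\<lambda>v. frechet_derivative (area \<gamma>) (at (\<phi> p)) (F p v))) (at p)"
    by (rule has_derivative_transform_within_open[OF _ opens(1) p]) (rule area)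
  then have d: "frechet_derivative (area \<gamma>) (at (\<phi> p)) (F p v) = frechet_derivative (area \<beta>) (at p) v" for v
    by (rule fun_cong[OF frechet_derivative_at])
  obtain G where G: "\<And>v. G (F p v) = v" "\<And>w. F p (G w) = w"
    using F_inverse[OF p] by metis
  show "area_grad_sq \<gamma> (\<phi> p) = area_grad_sq \<beta> p"
  proof (rule antisym)
    show "area_grad_sq \<beta> p \<le> area_grad_sq \<gamma> (\<phi> p)"
      by (rule area_grad_sq_le[OF F_isometric[OF p] d area_grad_sq_pos[OF p pos(1)]])
    show "area_grad_sq \<gamma> (\<phi> p) \<le> area_grad_sq \<beta> p"
    proof (rule area_grad_sq_le[where L = G])
      show "metric_form (g_beta \<beta>) p (G v) (G w) = metric_form (g_beta \<gamma>) (\<phi> p) v w" for v w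
        using F_isometric[OF p, of "G v" "G w"] by (simp add: G)
      show "frechet_derivative (area \<beta>) (at p) (G v) = frechet_derivative (area \<gamma>) (at (\<phi> p)) v" for v
        using d[of "G v"] by (simp add: G)
    qed (rule area_grad_sq_pos[OF maps_into[OF p] pos(2)])
  qed
qed

text \<open>
  The minimum of \<open>((a + b)\<^sup>2 + \<beta>\<^sup>2 a\<^sup>2) / (a b)\<close> on the quadrant, by completing the square: with
  \<open>s = \<surd>(1 + \<beta>\<^sup>2)\<close> the numerator is \<open>(2 + 2 s) a b + (s a - b)\<^sup>2\<close>.
\<close>

definition grad_bound :: "real \<Rightarrow> real" where
  "grad_bound \<beta> = 2 + 2 * sqrt (1 + \<beta>\<^sup>2)"

lemma area_grad_sq_bound: "grad_bound \<beta> * area \<beta> x \<le> area_grad_sq \<beta> x"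
proof -
  define s where "s = sqrt (1 + \<beta>\<^sup>2)"
  have s: "s\<^sup>2 = 1 + \<beta>\<^sup>2"
    by (simp add: s_def)
  define a b where "a = x $ 3" and "b = x $ 3 + \<beta> * x $ 4"
  have "area_grad_sq \<beta> x = (a + b)\<^sup>2 + (\<beta> * a)\<^sup>2"
    by (simp add: area_grad_sq_def a_def b_def)
  also have "\<dots> = (2 + 2 * s) * (a * b) + (s * a - b)\<^sup>2"
    using s by algebra
  finally show ?thesis
    by (simp add: grad_bound_def area_def a_def b_def s_def)
qed

lemma area_grad_sq_bound_attained:
  assumes "\<beta> > 0"
  obtains x where "x \<in> quadrant" "area_grad_sq \<beta> x = grad_bound \<beta> * area \<beta> x"
proof
  define s where "s = sqrt (1 + \<beta>\<^sup>2)"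
  have s: "s\<^sup>2 = 1 + \<beta>\<^sup>2"
    by (simp add: s_def)
  have "s > 1"
    using assms by (simp add: s_def)
  \<comment> \<open>The point with \<open>a = 1\<close> and \<open>b = s\<close>, where the square \<open>(s a - b)\<^sup>2\<close> vanishes; \<open>s > 1\<close> puts it into the
     quadrant.\<close>
  let ?x = "\<chi> k::4. if k = 3 then 1 else if k = 4 then (s - 1) / \<beta> else 0"
  show "?x \<in> quadrant"
    using assms \<open>s > 1\<close> by (simp add: quadrant_def)
  have "area_grad_sq \<beta> ?x = (1 + s)\<^sup>2 + \<beta>\<^sup>2"
    using assms by (simp add: area_grad_sq_def)
  also have "\<dots> = (2 + 2 * s) * s"
    using s by algebra
  finally show "area_grad_sq \<beta> ?x = grad_bound \<beta> * area \<beta> ?x"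
    using assms by (simp add: area_def grad_bound_def s_def)
qed

theorem g_beta_not_isometric:
  assumes pos: "\<beta> > 0" "\<gamma> > 0" and ne: "\<beta> \<noteq> \<gamma>"
  shows "\<not> isometric quadrant (g_beta \<beta>) quadrant (g_beta \<gamma>)"
proof
  assume "isometric quadrant (g_beta \<beta>) quadrant (g_beta \<gamma>)"
  then obtain \<phi> where iso: "isometry quadrant (g_beta \<beta>) quadrant (g_beta \<gamma>) \<phi>"
    by (auto simp: isometric_def)
  interpret metric_isometry quadrant "g_beta \<beta>" quadrant "g_beta \<gamma>" \<phi>
    by unfold_locales (use g_beta_pseudo pos iso in auto)
  note inv = isometry_preserves_area[OF pos iso]
  have "grad_bound \<gamma> \<le> grad_bound \<beta>"
  proof -
    obtain p where p: "p \<in> quadrant" "area_grad_sq \<beta> p = grad_bound \<beta> * area \<beta> p"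
      using area_grad_sq_bound_attained[OF pos(1)] by blast
    then have "grad_bound \<gamma> * area \<beta> p \<le> grad_bound \<beta> * area \<beta> p"
      using area_grad_sq_bound[of \<gamma> "\<phi> p"] by (simp add: inv)
    then show ?thesis
      using area_pos[OF p(1) pos(1)] by simp
  qed
  moreover have "grad_bound \<beta> \<le> grad_bound \<gamma>"
  proof -
    obtain q where q: "q \<in> quadrant" "area_grad_sq \<gamma> q = grad_bound \<gamma> * area \<gamma> q"
      using area_grad_sq_bound_attained[OF pos(2)] by blast
    obtain p where p: "p \<in> quadrant" "\<phi> p = q"
      using onto[OF q(1)] by blast
    have "grad_bound \<beta> * area \<beta> p \<le> grad_bound \<gamma> * area \<beta> p"
      using area_grad_sq_bound[of \<beta> p] q(2) inv[OF p(1)] p(2) by simp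
    then show ?thesis
      using area_pos[OF p(1) pos(1)] by simp
  qed
  ultimately have "\<beta>\<^sup>2 = \<gamma>\<^sup>2"
    by (simp add: grad_bound_def)
  then show False
    using pos ne by (simp add: power2_eq_iff)
qed

theorem theorem4p1:
  shows "(\<forall>\<beta>::real. \<beta> > 0 \<longrightarrow>
            riemannian_manifold quadrant (g_beta \<beta>) \<and>
            irreducible_manifold quadrant (g_beta \<beta>) \<and>
            skew_tsankov quadrant (g_beta \<beta>) \<and>
            (\<forall>x\<in>quadrant. scalar_curvature (g_beta \<beta>) x =
               - 2 * inverse (x $ 3) * inverse (x $ 3 + \<beta> * x $ 4))) \<and>
         (\<forall>\<beta>1 \<beta>2::real. \<beta>1 > 0 \<longrightarrow> \<beta>2 > 0 \<longrightarrow> \<beta>1 \<noteq> \<beta>2 \<longrightarrow>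
            \<not> isometric quadrant (g_beta \<beta>1) quadrant (g_beta \<beta>2))"
  using g_beta_riemannian g_beta_irreducible g_beta_skew_tsankov g_beta_scalar_curvature
    g_beta_not_isometric by blast

end
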